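(* Let $\mathcal{M}$ be a von Neumann algebra with no central summands of type $I_1$. Then a map $\Phi:\mathcal{M}\rightarrow\mathcal{M}$ is a nonlinear mixed Jordan triple $*$-derivation if and only if $\Phi$ is an additive $*$-derivation.
   Context: A von Neumann algebra $\mathcal{M}$ is a weakly closed, self-adjoint algebra of operators on a complex Hilbert space $\mathcal{H}$ containing the identity operator $I$. For $A,B\in\mathcal{M}$, define $[A,B]_{*}=AB-BA^{*}$ and $A\bullet B=AB+BA^{*}$. A (not necessarily additive or linear) map $\Phi:\mathcal{M}\to\mathcal{M}$ is a nonlinear mixed Jordan triple $*$-derivation if $\Phi([A\bullet B, C]_{*})=[\Phi(A)\bullet B, C]_{*}+[A\bullet \Phi(B), C]_{*}+[A\bullet B, \Phi(C)]_{*}$ for all $A,B,C\in\mathcal{M}$. An additive $*$-derivation on $\mathcal{M}$ is an additive map $\Phi:\mathcal{M}\to\mathcal{M}$ (no homogeneity over $\mathbb{C}$ is assumed) such that $\Phi(AB)=\Phi(A)B+A\Phi(B)$ for all $A,B\in\mathcal{M}$ and $\Phi(A^{*})=\Phi(A)^{*}$ for all $A\in\mathcal{M}$. *)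

theory Defs
  imports "HOL-Analysis.Analysis"
begin

text \<open>
  The real inner product and norm inherited from \<open>real_inner\<close> are tied to the complex inner
  product by \<open>inner_eq_Re_cinner\<close>; positive definiteness is therefore inherited as well.
  The form \<open>cinner\<close> is linear in its first argument.
\<close>

class complex_inner = real_inner +
  fixes scaleC :: "complex \<Rightarrow> 'a \<Rightarrow> 'a" (infixr \<open>*\<^sub>C\<close> 75)
    and cinner :: "'a \<Rightarrow> 'a \<Rightarrow> complex"
  assumes scaleC_add_right: "c *\<^sub>C (x + y) = c *\<^sub>C x + c *\<^sub>C y"
    and scaleC_add_left: "(c + d) *\<^sub>C x = c *\<^sub>C x + d *\<^sub>C x"
    and scaleC_scaleC: "c *\<^sub>C (d *\<^sub>C x) = (c * d) *\<^sub>C x"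
    and scaleC_one: "1 *\<^sub>C x = x"
    and scaleR_scaleC: "scaleR r x = complex_of_real r *\<^sub>C x"
    and cinner_commute: "cinner x y = cnj (cinner y x)"
    and cinner_add_left: "cinner (x + y) z = cinner x z + cinner y z"
    and cinner_scaleC_left: "cinner (c *\<^sub>C x) y = c * cinner x y"
    and inner_eq_Re_cinner: "inner x y = Re (cinner x y)"

class complex_hilbert_space = complex_inner + complete_space

instantiation complex :: complex_hilbert_space
begin

definition "scaleC_complex (c::complex) (x::complex) = c * x"
definition "cinner_complex (x::complex) (y::complex) = x * cnj y"

instance
  by standard
    (auto simp: scaleC_complex_def cinner_complex_def algebra_simps scaleR_conv_of_real inner_complex_def)

end

lemma norm_scaleC: "norm (c *\<^sub>C x) = cmod c * norm (x::'a::complex_inner)"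
proof -
  have "cinner (c *\<^sub>C x) (c *\<^sub>C x) = c * cnj c * cinner x x"
    by (metis cinner_commute cinner_scaleC_left complex_cnj_mult mult.assoc mult.commute)
  then have "inner (c *\<^sub>C x) (c *\<^sub>C x) = (cmod c)\<^sup>2 * inner x x"
    by (simp only: inner_eq_Re_cinner complex_norm_square[symmetric]) (simp flip: of_real_power)
  then show ?thesis
    by (simp add: norm_eq_sqrt_inner real_sqrt_mult)
qed

lemma bounded_linear_scaleC: "bounded_linear (\<lambda>x::'a::complex_inner. c *\<^sub>C x)"
proof (rule bounded_linear_intro)
  show "c *\<^sub>C (x + y) = c *\<^sub>C x + c *\<^sub>C y" for x y :: 'a
    by (rule scaleC_add_right)
  show "c *\<^sub>C (r *\<^sub>R x) = r *\<^sub>R (c *\<^sub>C x)" for r and x :: 'a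
    by (simp add: scaleR_scaleC scaleC_scaleC mult.commute)
  show "norm (c *\<^sub>C x) \<le> norm x * cmod c" for x :: 'a
    by (simp add: norm_scaleC mult.commute)
qed

text \<open>
  The library type \<open>'h \<Rightarrow>\<^sub>L 'h\<close> consists of the bounded real-linear operators; the bounded
  operators of a complex Hilbert space are its complex-linear members.
\<close>

definition bounded_ops :: "('h::complex_hilbert_space \<Rightarrow>\<^sub>L 'h) set" where
  "bounded_ops = {A. \<forall>c x. blinfun_apply A (c *\<^sub>C x) = c *\<^sub>C blinfun_apply A x}"

lift_definition scale_op ::
    "complex \<Rightarrow> ('h::complex_hilbert_space \<Rightarrow>\<^sub>L 'h) \<Rightarrow> 'h \<Rightarrow>\<^sub>L 'h" is
  "\<lambda>c A x. c *\<^sub>C A x"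
  by (rule bounded_linear_compose[OF bounded_linear_scaleC])

definition adj :: "('h::complex_hilbert_space \<Rightarrow>\<^sub>L 'h) \<Rightarrow> 'h \<Rightarrow>\<^sub>L 'h" where
  "adj A = (THE B. \<forall>x y. cinner (blinfun_apply A x) y = cinner x (blinfun_apply B y))"

text \<open>
  The coarsest topology on the bounded operators making all maps
  \<open>A \<mapsto> cinner (A x) y\<close> continuous; the function space carries the product topology
  (compare \<open>strong_operator_topology\<close> in the library).
\<close>

definition weak_operator_topology :: "('h::complex_hilbert_space \<Rightarrow>\<^sub>L 'h) topology" where
  "weak_operator_topology =
     pullback_topology bounded_ops (\<lambda>A (x, y). cinner (blinfun_apply A x) y) euclidean"

definition von_neumann_algebra :: "('h::complex_hilbert_space \<Rightarrow>\<^sub>L 'h) set \<Rightarrow> bool" where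
  "von_neumann_algebra M \<longleftrightarrow>
     M \<subseteq> bounded_ops \<and>
     id_blinfun \<in> M \<and>
     (\<forall>A\<in>M. \<forall>B\<in>M. A + B \<in> M) \<and>
     (\<forall>c. \<forall>A\<in>M. scale_op c A \<in> M) \<and>
     (\<forall>A\<in>M. \<forall>B\<in>M. A o\<^sub>L B \<in> M) \<and>
     (\<forall>A\<in>M. adj A \<in> M) \<and>
     closedin weak_operator_topology M"

definition projection :: "('h::complex_hilbert_space \<Rightarrow>\<^sub>L 'h) \<Rightarrow> bool" where
  "projection P \<longleftrightarrow> P o\<^sub>L P = P \<and> adj P = P"

definition central_projection ::
    "('h::complex_hilbert_space \<Rightarrow>\<^sub>L 'h) set \<Rightarrow> ('h \<Rightarrow>\<^sub>L 'h) \<Rightarrow> bool" where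
  "central_projection M P \<longleftrightarrow> P \<in> M \<and> projection P \<and> (\<forall>A\<in>M. A o\<^sub>L P = P o\<^sub>L A)"

definition abelian_projection ::
    "('h::complex_hilbert_space \<Rightarrow>\<^sub>L 'h) set \<Rightarrow> ('h \<Rightarrow>\<^sub>L 'h) \<Rightarrow> bool" where
  "abelian_projection N E \<longleftrightarrow> E \<in> N \<and> projection E \<and>
     (\<forall>A\<in>N. \<forall>B\<in>N. (E o\<^sub>L A o\<^sub>L E) o\<^sub>L (E o\<^sub>L B o\<^sub>L E) = (E o\<^sub>L B o\<^sub>L E) o\<^sub>L (E o\<^sub>L A o\<^sub>L E))"

definition equivalent_projections ::
    "('h::complex_hilbert_space \<Rightarrow>\<^sub>L 'h) set \<Rightarrow> ('h \<Rightarrow>\<^sub>L 'h) \<Rightarrow> ('h \<Rightarrow>\<^sub>L 'h) \<Rightarrow> bool" where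
  "equivalent_projections N E F \<longleftrightarrow> (\<exists>V\<in>N. adj V o\<^sub>L V = E \<and> V o\<^sub>L adj V = F)"

text \<open>
  An algebra \<open>N\<close> with unit \<open>P\<close> (acting on the range of \<open>P\<close>) is of type \<open>I\<^sub>n\<close>, for finite \<open>n\<close>,
  if \<open>P\<close> is the sum of \<open>n\<close> mutually orthogonal, pairwise equivalent abelian projections of \<open>N\<close>.
\<close>

definition type_I ::
    "nat \<Rightarrow> ('h::complex_hilbert_space \<Rightarrow>\<^sub>L 'h) set \<Rightarrow> ('h \<Rightarrow>\<^sub>L 'h) \<Rightarrow> bool" where
  "type_I n N P \<longleftrightarrow> (\<exists>E :: nat \<Rightarrow> 'h \<Rightarrow>\<^sub>L 'h.
     (\<forall>i<n. abelian_projection N (E i)) \<and>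
     (\<forall>i<n. \<forall>j<n. i \<noteq> j \<longrightarrow> E i o\<^sub>L E j = 0) \<and>
     (\<forall>i<n. \<forall>j<n. equivalent_projections N (E i) (E j)) \<and>
     (\<Sum>i<n. E i) = P)"

definition central_summand ::
    "('h::complex_hilbert_space \<Rightarrow>\<^sub>L 'h) set \<Rightarrow> ('h \<Rightarrow>\<^sub>L 'h) \<Rightarrow> ('h \<Rightarrow>\<^sub>L 'h) set" where
  "central_summand M P = {A o\<^sub>L P | A. A \<in> M}"

definition no_central_summands_of_type_I ::
    "nat \<Rightarrow> ('h::complex_hilbert_space \<Rightarrow>\<^sub>L 'h) set \<Rightarrow> bool" where
  "no_central_summands_of_type_I n M \<longleftrightarrow>
     \<not> (\<exists>P. central_projection M P \<and> P \<noteq> 0 \<and> type_I n (central_summand M P) P)"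

definition star_commutator ::
    "('h::complex_hilbert_space \<Rightarrow>\<^sub>L 'h) \<Rightarrow> ('h \<Rightarrow>\<^sub>L 'h) \<Rightarrow> 'h \<Rightarrow>\<^sub>L 'h" where
  "star_commutator A B = (A o\<^sub>L B) - (B o\<^sub>L adj A)"

definition star_jordan ::
    "('h::complex_hilbert_space \<Rightarrow>\<^sub>L 'h) \<Rightarrow> ('h \<Rightarrow>\<^sub>L 'h) \<Rightarrow> 'h \<Rightarrow>\<^sub>L 'h" where
  "star_jordan A B = (A o\<^sub>L B) + (B o\<^sub>L adj A)"

definition nonlinear_mixed_jordan_triple_star_derivation ::
    "('h::complex_hilbert_space \<Rightarrow>\<^sub>L 'h) set \<Rightarrow> (('h \<Rightarrow>\<^sub>L 'h) \<Rightarrow> ('h \<Rightarrow>\<^sub>L 'h)) \<Rightarrow> bool" where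
  "nonlinear_mixed_jordan_triple_star_derivation M \<Phi> \<longleftrightarrow>
     (\<forall>A\<in>M. \<forall>B\<in>M. \<forall>C\<in>M.
        \<Phi> (star_commutator (star_jordan A B) C) =
          star_commutator (star_jordan (\<Phi> A) B) C +
          star_commutator (star_jordan A (\<Phi> B)) C +
          star_commutator (star_jordan A B) (\<Phi> C))"

definition additive_star_derivation ::
    "('h::complex_hilbert_space \<Rightarrow>\<^sub>L 'h) set \<Rightarrow> (('h \<Rightarrow>\<^sub>L 'h) \<Rightarrow> ('h \<Rightarrow>\<^sub>L 'h)) \<Rightarrow> bool" where
  "additive_star_derivation M \<Phi> \<longleftrightarrow>
     (\<forall>A\<in>M. \<forall>B\<in>M. \<Phi> (A + B) = \<Phi> A + \<Phi> B) \<and>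
     (\<forall>A\<in>M. \<forall>B\<in>M. \<Phi> (A o\<^sub>L B) = (\<Phi> A o\<^sub>L B) + (A o\<^sub>L \<Phi> B)) \<and>
     (\<forall>A\<in>M. \<Phi> (adj A) = adj (\<Phi> A))"

end

theory Submission
  imports Defs
begin

text \<open>
  The nontrivial direction rests on additivity.  Once \<open>\<Phi>\<close> is additive, the triple products
  \<open>(1, \<i>, C)\<close> and \<open>(1, B, C)\<close> yield \<open>\<Phi>(\<i>C) = \<i> \<Phi>(C)\<close> and the rules for \<open>BC - CB\<^sup>*\<close> and
  \<open>BC + CB\<^sup>*\<close>, from which the product rule and compatibility with the involution follow
  (\<open>additive_imp_additive_star_derivation\<close>).

  For additivity, fix a projection \<open>P\<close> in \<open>M\<close>, let \<open>Q = 1 - P\<close>, and consider the defect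
  \<open>\<Phi>(X + Y) - \<Phi>(X) - \<Phi>(Y)\<close>.  Whenever a triple product kills one of the two summands, or sends
  both to elements on which additivity is known, the same triple product kills the defect.
  Suitable choices show that \<open>\<Phi>\<close> is additive across the four Peirce corners of \<open>P\<close> and within the
  two off-diagonal ones.  Within the diagonal corners one only obtains that the defect is
  annihilated by \<open>Q M P\<close> or by \<open>P M Q\<close>; altogether \<open>(P Z - Z P) T = 0\<close> for every defect \<open>T\<close> and
  every \<open>Z\<close> in \<open>M\<close> (\<open>commutator_annihilates_defect\<close>).

  The defect does not depend on \<open>P\<close>, so the relation holds for all projections of \<open>M\<close>
  simultaneously.  It remains to see that an element \<open>T\<close> killed by all commutators with
  projections is zero
  (\<open>annihilator_of_projection_commutators\<close>).  The range projection \<open>R\<close> of \<open>T T\<^sup>*\<close> is killed by the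
  same commutators, and this makes \<open>R\<close> central and all projections of \<open>M\<close> central on \<open>R\<close>.  Then
  \<open>R M\<close> is abelian: for a self-adjoint contraction \<open>B = (2E - 1) \<bar>B\<bar>\<close> the commutators with \<open>B\<close>
  reduce on \<open>R\<close> to those with \<open>\<bar>B\<bar> - 1/2\<close>, which has norm at most \<open>1/2\<close>, and iteration makes them
  vanish.  Without central summands of type \<open>I\<^sub>1\<close> this leaves \<open>R = 0\<close>.

  The functional calculus used here is obtained by hand from weak closedness: kernel projections
  are strong limits of even powers of a self-adjoint contraction, and square roots are norm limits
  of an iteration.
\<close>

section \<open>Adjoints of bounded operators\<close>

notation blinfun_compose (infixl "\<cdot>" 70)
notation adj ("_\<^sup>\<star>" [1000] 1000)

instance complex_hilbert_space \<subseteq> banach ..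

lemma inner_scaleC_left: "inner (c *\<^sub>C x) y = inner x (cnj c *\<^sub>C (y::'a::complex_inner))"
proof -
  have "cinner x (cnj c *\<^sub>C y) = c * cinner x y"
    by (metis cinner_commute cinner_scaleC_left complex_cnj_cnj complex_cnj_mult)
  then show ?thesis
    by (simp add: inner_eq_Re_cinner cinner_scaleC_left)
qed

lemma Im_cinner: "Im (cinner x y) = - inner (\<i> *\<^sub>C x) (y::'a::complex_inner)"
  by (simp add: inner_eq_Re_cinner cinner_scaleC_left)

text \<open>
  The representing vector minimises \<open>\<parallel>x\<parallel>\<^sup>2 - 2 f x\<close>: for \<open>f = inner _ z\<close> this function is
  \<open>\<parallel>x - z\<parallel>\<^sup>2 - \<parallel>z\<parallel>\<^sup>2\<close>.
\<close>

lemma riesz_representation: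
  fixes f :: "'a::{real_inner, complete_space} \<Rightarrow> real"
  assumes f: "bounded_linear f"
  shows "\<exists>z. \<forall>x. f x = inner x z"
proof -
  interpret f: bounded_linear f by fact
  define J where "J x = (norm x)\<^sup>2 - 2 * f x" for x
  obtain K where K: "\<And>x. norm (f x) \<le> norm x * K"
    using f.bounded by blast
  have J_lower: "- K\<^sup>2 \<le> J x" for x
  proof -
    have "2 * f x \<le> 2 * (norm x * K)"
      using K[of x] by simp
    moreover have "0 \<le> (norm x - K)\<^sup>2" by simp
    ultimately show ?thesis
      by (simp add: J_def power2_eq_square algebra_simps)
  qed
  define m where "m = (INF x. J x)"
  have bdd: "bdd_below (range J)"
    by (rule bdd_belowI2[of _ "- K\<^sup>2"]) (rule J_lower)
  have m_le: "m \<le> J x" for x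
    unfolding m_def by (rule cINF_lower[OF bdd]) simp
  have "\<exists>x. J x < m + inverse (real (Suc n))" for n
    using cINF_less_iff[OF _ bdd, of "m + inverse (real (Suc n))"]
    by (simp add: m_def)
  then obtain x where x: "\<And>n. J (x n) < m + inverse (real (Suc n))"
    by metis
  \<comment> \<open>The parallelogram law applied to the midpoint makes a minimising sequence Cauchy.\<close>
  have par: "(norm (a - b))\<^sup>2 \<le> 2 * (J a - m) + 2 * (J b - m)" for a b
  proof -
    have "m \<le> J ((1/2) *\<^sub>R (a + b))" by (rule m_le)
    also have "J ((1/2) *\<^sub>R (a + b)) = (norm (a + b))\<^sup>2 / 4 - f a - f b"
      by (simp add: J_def f.scaleR f.add power_divide add_divide_distrib)
    finally have "4 * m \<le> (norm (a + b))\<^sup>2 - 4 * f a - 4 * f b" by simp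
    moreover have "(norm (a + b))\<^sup>2 + (norm (a - b))\<^sup>2 = 2 * (norm a)\<^sup>2 + 2 * (norm b)\<^sup>2"
      by (simp add: power2_norm_eq_inner algebra_simps inner_commute)
    ultimately show ?thesis
      by (simp add: J_def)
  qed
  have "Cauchy x"
  proof (rule metric_CauchyI)
    fix e :: real assume e: "0 < e"
    then obtain N where N: "inverse (real (Suc N)) < e\<^sup>2 / 4"
      using reals_Archimedean[of "e\<^sup>2 / 4"] by auto
    have "dist (x i) (x j) < e" if "N \<le> i" "N \<le> j" for i j
    proof -
      have "J (x k) - m < e\<^sup>2 / 4" if "N \<le> k" for k
      proof -
        have "inverse (real (Suc k)) \<le> inverse (real (Suc N))"
          using that by (intro le_imp_inverse_le) auto
        then show ?thesis using x[of k] N by linarith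
      qed
      then have "J (x i) - m < e\<^sup>2 / 4" "J (x j) - m < e\<^sup>2 / 4"
        using that by auto
      then have "(norm (x i - x j))\<^sup>2 < e\<^sup>2"
        using par[of "x i" "x j"] by simp
      then show ?thesis
        using e by (simp add: dist_norm power2_less_imp_less)
    qed
    then show "\<exists>M. \<forall>i\<ge>M. \<forall>j\<ge>M. dist (x i) (x j) < e" by blast
  qed
  then obtain z where z: "x \<longlonglongrightarrow> z"
    by (auto simp: Cauchy_convergent_iff convergent_def)
  have "(\<lambda>n. J (x n)) \<longlonglongrightarrow> J z"
    unfolding J_def by (intro tendsto_intros z f.tendsto)
  moreover have "(\<lambda>n. m + inverse (real (Suc n))) \<longlonglongrightarrow> m + 0"
    by (intro tendsto_intros LIMSEQ_inverse_real_of_nat)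
  ultimately have "J z \<le> m + 0"
    by (rule LIMSEQ_le) (use x less_imp_le in blast)
  then have Jz: "J z \<le> J y" for y
    using m_le[of y] by simp
  have "f y = inner y z" for y
  proof (rule ccontr)
    assume ne: "f y \<noteq> inner y z"
    define d where "d = inner y z - f y"
    have step: "0 \<le> t\<^sup>2 * (norm y)\<^sup>2 + 2 * t * d" for t
    proof -
      have "J (z + t *\<^sub>R y) = J z + t\<^sup>2 * (norm y)\<^sup>2 + 2 * t * d"
        unfolding J_def d_def power2_norm_eq_inner
        by (simp add: f.add f.scaleR algebra_simps inner_commute power2_eq_square)
      with Jz[of "z + t *\<^sub>R y"] show ?thesis by simp
    qed
    \<comment> \<open>Moving from \<open>z\<close> along \<open>y\<close> by the optimal amount \<open>- d / \<parallel>y\<parallel>\<^sup>2\<close> would decrease \<open>J\<close>.\<close>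
    define N where "N = (norm y)\<^sup>2"
    have N: "N > 0"
      using ne f.zero by (auto simp: N_def)
    have "(- d / N)\<^sup>2 * N + 2 * (- d / N) * d = - (d\<^sup>2 / N)"
      using N by (simp add: power2_eq_square field_simps)
    then have "d\<^sup>2 / N \<le> 0"
      using step[of "- d / N"] by (simp flip: N_def)
    with N have "d = 0"
      by (simp add: divide_le_0_iff)
    with ne show False
      by (simp add: d_def)
  qed
  then show ?thesis by blast
qed

lemma inner_right_eqI: "(\<And>x. inner x u = inner x v) \<Longrightarrow> u = (v::'a::real_inner)"
  by (metis inner_eq_zero_iff inner_diff_right right_minus_eq)

lemma bounded_opsD: "A \<in> bounded_ops \<Longrightarrow> A (c *\<^sub>C x) = c *\<^sub>C A x"
  by (simp add: bounded_ops_def)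

lemma adjoint_exists:
  fixes A :: "'h::complex_hilbert_space \<Rightarrow>\<^sub>L 'h"
  shows "\<exists>B :: 'h \<Rightarrow>\<^sub>L 'h. \<forall>x y. inner (A x) y = inner x (B y)"
proof -
  have "\<exists>z. \<forall>x. inner (A x) y = inner x z" for y
    by (rule riesz_representation)
       (intro bounded_linear_compose[OF bounded_linear_inner_left] blinfun.bounded_linear_right)
  then obtain B where B: "\<And>x y. inner (A x) y = inner x (B y)"
    by metis
  have "bounded_linear B"
  proof (rule bounded_linear_intro)
    show "B (x + y) = B x + B y" for x y
      by (rule inner_right_eqI) (simp add: inner_add_right flip: B)
    show "B (r *\<^sub>R x) = r *\<^sub>R B x" for r x
      by (rule inner_right_eqI) (simp flip: B)
    show "norm (B y) \<le> norm y * norm A" for y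
    proof (cases "norm (B y) = 0")
      case False
      have "(norm (B y))\<^sup>2 = inner (A (B y)) y"
        by (simp add: power2_norm_eq_inner B)
      also have "\<dots> \<le> norm (A (B y)) * norm y"
        by (rule norm_cauchy_schwarz)
      also have "\<dots> \<le> (norm A * norm (B y)) * norm y"
        by (intro mult_right_mono norm_blinfun) auto
      finally have "norm (B y) * norm (B y) \<le> norm (B y) * (norm y * norm A)"
        by (simp add: power2_eq_square mult_ac)
      with False show ?thesis by simp
    qed simp
  qed
  then show ?thesis
    using B by (intro exI[of _ "Blinfun B"]) (simp add: bounded_linear_Blinfun_apply)
qed

text \<open>
  For complex-linear operators the imaginary part of a sesquilinear form is determined by its real
  part, so adjoints can be computed with the real inner product alone.
\<close>

lemma adj_eqI:
  assumes A: "A \<in> bounded_ops" and B: "\<And>x y. inner (blinfun_apply A x) y = inner x (blinfun_apply B y)"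
  shows "A\<^sup>\<star> = B"
  unfolding adj_def
proof (rule the_equality)
  show "\<forall>x y. cinner (A x) y = cinner x (B y)"
  proof (intro allI complex_eqI)
    fix x y
    show "Re (cinner (A x) y) = Re (cinner x (B y))"
      using B by (simp add: inner_eq_Re_cinner)
    show "Im (cinner (A x) y) = Im (cinner x (B y))"
      using B[of "\<i> *\<^sub>C x" y] by (simp add: Im_cinner bounded_opsD[OF A])
  qed
next
  fix C assume "\<forall>x y. cinner (A x) y = cinner x (blinfun_apply C y)"
  then have "inner x (C y) = inner x (B y)" for x y
    by (metis B inner_eq_Re_cinner)
  then have "inner (C y - B y) (C y - B y) = 0" for y
    by (simp add: inner_diff_right)
  then show "C = B"
    by (intro blinfun_eqI) simp
qed

lemma inner_adj: "A \<in> bounded_ops \<Longrightarrow> inner (A x) y = inner x (A\<^sup>\<star> y)"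
  using adjoint_exists[of A] adj_eqI by metis

lemma inner_adj': "A \<in> bounded_ops \<Longrightarrow> inner x (A y) = inner (A\<^sup>\<star> x) y"
  by (metis inner_adj inner_commute)

lemma bounded_ops_adj: "A \<in> bounded_ops \<Longrightarrow> A\<^sup>\<star> \<in> bounded_ops"
proof -
  assume A: "A \<in> bounded_ops"
  have "A\<^sup>\<star> (c *\<^sub>C y) = c *\<^sub>C A\<^sup>\<star> y" for c y
  proof (rule inner_right_eqI)
    fix x
    have "inner x (A\<^sup>\<star> (c *\<^sub>C y)) = inner (A (cnj c *\<^sub>C x)) y"
      by (simp add: bounded_opsD[OF A] inner_scaleC_left flip: inner_adj[OF A])
    also have "\<dots> = inner x (c *\<^sub>C A\<^sup>\<star> y)"
      by (simp add: inner_adj[OF A] inner_scaleC_left)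
    finally show "inner x (A\<^sup>\<star> (c *\<^sub>C y)) = inner x (c *\<^sub>C A\<^sup>\<star> y)" .
  qed
  then show ?thesis by (simp add: bounded_ops_def)
qed

lemma scale_op_apply [simp]: "scale_op c A x = c *\<^sub>C A x"
  by (simp add: scale_op.rep_eq)

lemma bounded_ops_closed:
  assumes "A \<in> bounded_ops" "B \<in> bounded_ops"
  shows "A + B \<in> bounded_ops" "A - B \<in> bounded_ops" "- A \<in> bounded_ops"
    "A \<cdot> B \<in> bounded_ops" "scale_op c A \<in> bounded_ops"
proof -
  have neg: "- (c *\<^sub>C x) = c *\<^sub>C (- x)" for c and x :: 'a
    by (metis bounded_linear_scaleC linear_neg bounded_linear.linear)
  show "A + B \<in> bounded_ops" "- A \<in> bounded_ops"
    "A \<cdot> B \<in> bounded_ops" "scale_op c A \<in> bounded_ops"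
    using assms by (auto simp: bounded_ops_def blinfun.bilinear_simps scaleC_add_right neg
        scaleC_scaleC mult.commute)
  show "A - B \<in> bounded_ops"
    using assms by (auto simp: bounded_ops_def blinfun.bilinear_simps)
      (metis bounded_linear_scaleC linear_diff bounded_linear.linear)
qed

lemma id_in_bounded_ops: "id_blinfun \<in> bounded_ops"
  by (simp add: bounded_ops_def)

lemma adj_involution: "A \<in> bounded_ops \<Longrightarrow> (A\<^sup>\<star>)\<^sup>\<star> = A"
  by (rule adj_eqI) (auto simp: bounded_ops_adj inner_adj')

lemma adj_algebra:
  assumes "A \<in> bounded_ops" "B \<in> bounded_ops"
  shows "(A + B)\<^sup>\<star> = A\<^sup>\<star> + B\<^sup>\<star>" "(A - B)\<^sup>\<star> = A\<^sup>\<star> - B\<^sup>\<star>" "(- A)\<^sup>\<star> = - A\<^sup>\<star>"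
    "(A \<cdot> B)\<^sup>\<star> = B\<^sup>\<star> \<cdot> A\<^sup>\<star>" "(scale_op c A)\<^sup>\<star> = scale_op (cnj c) (A\<^sup>\<star>)"
proof -
  have adj_scale: "A\<^sup>\<star> (c *\<^sub>C y) = c *\<^sub>C A\<^sup>\<star> y" for c y
    by (rule bounded_opsD[OF bounded_ops_adj[OF assms(1)]])
  show "(A + B)\<^sup>\<star> = A\<^sup>\<star> + B\<^sup>\<star>" "(A - B)\<^sup>\<star> = A\<^sup>\<star> - B\<^sup>\<star>" "(- A)\<^sup>\<star> = - A\<^sup>\<star>"
    "(A \<cdot> B)\<^sup>\<star> = B\<^sup>\<star> \<cdot> A\<^sup>\<star>" "(scale_op c A)\<^sup>\<star> = scale_op (cnj c) (A\<^sup>\<star>)"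
    using assms by (auto intro!: adj_eqI simp: bounded_ops_closed blinfun.bilinear_simps
        inner_add_left inner_add_right inner_diff_left inner_diff_right inner_adj inner_scaleC_left
        adj_scale)
qed

lemma adj_id: "id_blinfun\<^sup>\<star> = id_blinfun"
  by (rule adj_eqI) (auto simp: id_in_bounded_ops)

section \<open>Self-adjoint operator algebras\<close>

lemma compose_assoc: "A \<cdot> B \<cdot> C = A \<cdot> (B \<cdot> C)"
  by (rule blinfun_eqI) simp

lemma compose_id [simp]: "id_blinfun \<cdot> A = A" "A \<cdot> id_blinfun = A"
  by (auto intro: blinfun_eqI)

lemmas compose_distribs =
  bounded_bilinear.add_left[OF bounded_bilinear_blinfun_compose]
  bounded_bilinear.add_right[OF bounded_bilinear_blinfun_compose]
  bounded_bilinear.diff_left[OF bounded_bilinear_blinfun_compose]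
  bounded_bilinear.diff_right[OF bounded_bilinear_blinfun_compose]
  bounded_bilinear.minus_left[OF bounded_bilinear_blinfun_compose]
  bounded_bilinear.minus_right[OF bounded_bilinear_blinfun_compose]
  bounded_bilinear.zero_left[OF bounded_bilinear_blinfun_compose]
  bounded_bilinear.zero_right[OF bounded_bilinear_blinfun_compose]
  bounded_bilinear.scaleR_left[OF bounded_bilinear_blinfun_compose]
  bounded_bilinear.scaleR_right[OF bounded_bilinear_blinfun_compose]

lemmas compose_simps = compose_assoc compose_distribs

lemma scale_op_minus_one: "scale_op (- 1) A = - A"
proof (rule blinfun_eqI)
  fix x
  have "(- 1) *\<^sub>C A x = scaleR (- 1) (A x)"
    by (subst scaleR_scaleC) simp
  then show "blinfun_apply (scale_op (- 1) A) x = blinfun_apply (- A) x"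
    by (simp add: blinfun.bilinear_simps)
qed

lemma scaleR_scale_op: "r *\<^sub>R A = scale_op (of_real r) A"
  by (rule blinfun_eqI) (simp add: blinfun.bilinear_simps scaleR_scaleC)

lemma scale_op_simps:
  "scale_op c (A + B) = scale_op c A + scale_op c B"
  "scale_op c (A - B) = scale_op c A - scale_op c B"
  "scale_op c (- A) = - scale_op c A"
  "scale_op c (scale_op d A) = scale_op (c * d) A"
  "scale_op (c + d) A = scale_op c A + scale_op d A"
  "scale_op (- c) A = - scale_op c A"
  "scale_op 1 A = A"
  "scale_op c 0 = 0"
  "scale_op c A \<cdot> B = scale_op c (A \<cdot> B)"
proof -
  show add: "scale_op c (A + B) = scale_op c A + scale_op c B" for A B
    by (rule blinfun_eqI) (simp add: blinfun.add_left scaleC_add_right)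
  show scale: "scale_op c (scale_op d A) = scale_op (c * d) A" for c d A
    by (rule blinfun_eqI) (simp add: scaleC_scaleC)
  show uminus_right: "scale_op c (- A) = - scale_op c A" for A
    by (simp add: scale mult.commute flip: scale_op_minus_one)
  show "scale_op c (A - B) = scale_op c A - scale_op c B"
    using add[of A "- B"] by (simp add: uminus_right)
  show "scale_op (c + d) A = scale_op c A + scale_op d A"
    by (rule blinfun_eqI) (simp add: blinfun.add_left scaleC_add_left)
  show "scale_op (- c) A = - scale_op c A"
    by (simp add: scale flip: scale_op_minus_one)
  show "scale_op 1 A = A"
    by (rule blinfun_eqI) (simp add: scaleC_one)
  show "scale_op c 0 = 0"
    using add[of 0 0] by simp
  show "scale_op c A \<cdot> B = scale_op c (A \<cdot> B)"
    by (rule blinfun_eqI) simp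
qed

lemma compose_scale_op: "A \<in> bounded_ops \<Longrightarrow> A \<cdot> scale_op c B = scale_op c (A \<cdot> B)"
  by (rule blinfun_eqI) (simp add: bounded_opsD)

lemma scale_op_eq_0_iff: "scale_op c A = 0 \<longleftrightarrow> c = 0 \<or> A = 0"
proof
  assume "scale_op c A = 0"
  then have "scale_op (inverse c) (scale_op c A) = 0"
    by (simp add: scale_op_simps)
  then show "c = 0 \<or> A = 0"
    by (cases "c = 0") (simp_all add: scale_op_simps(4,7))
next
  assume "c = 0 \<or> A = 0"
  moreover have "scale_op 0 A = 0"
    using scale_op_simps(5)[of 0 0 A] by simp
  ultimately show "scale_op c A = 0"
    by (auto simp: scale_op_simps)
qed

lemma double_eq_iff: "a + a = b + b \<longleftrightarrow> a = (b :: 'a::real_vector)"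
  by (simp flip: scaleR_2)

lemma double_eq_0_iff: "a + a = 0 \<longleftrightarrow> a = (0 :: 'a::real_vector)"
  by (simp flip: scaleR_2)

lemma eq_uminus_iff: "a = - a \<longleftrightarrow> a = (0 :: 'a::real_vector)"
  using double_eq_0_iff[of a] by (simp add: eq_neg_iff_add_eq_0)

locale operator_star_algebra =
  fixes M :: "('h::complex_hilbert_space \<Rightarrow>\<^sub>L 'h) set"
  assumes bounded_opsI [intro, simp]: "A \<in> M \<Longrightarrow> A \<in> bounded_ops"
    and id_mem [intro, simp]: "id_blinfun \<in> M"
    and add_mem [intro, simp]: "A \<in> M \<Longrightarrow> B \<in> M \<Longrightarrow> A + B \<in> M"
    and scale_mem [intro, simp]: "A \<in> M \<Longrightarrow> scale_op c A \<in> M"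
    and compose_mem [intro, simp]: "A \<in> M \<Longrightarrow> B \<in> M \<Longrightarrow> A \<cdot> B \<in> M"
    and adj_mem [intro, simp]: "A \<in> M \<Longrightarrow> A\<^sup>\<star> \<in> M"
begin

lemma minus_mem [intro, simp]: "A \<in> M \<Longrightarrow> - A \<in> M"
  using scale_mem[of A "- 1"] by (simp add: scale_op_minus_one)

lemma diff_mem [intro, simp]: "A \<in> M \<Longrightarrow> B \<in> M \<Longrightarrow> A - B \<in> M"
  using add_mem[of A "- B"] by simp

lemma zero_mem [intro, simp]: "0 \<in> M"
  using diff_mem[OF id_mem id_mem] by simp

lemma scaleR_mem [intro, simp]: "A \<in> M \<Longrightarrow> r *\<^sub>R A \<in> M"
  by (simp add: scaleR_scale_op)

lemma adj_mem_simps [simp]: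
  assumes "A \<in> M"
  shows "B \<in> M \<Longrightarrow> (A + B)\<^sup>\<star> = A\<^sup>\<star> + B\<^sup>\<star>" "B \<in> M \<Longrightarrow> (A - B)\<^sup>\<star> = A\<^sup>\<star> - B\<^sup>\<star>"
    "B \<in> M \<Longrightarrow> (A \<cdot> B)\<^sup>\<star> = B\<^sup>\<star> \<cdot> A\<^sup>\<star>" "(- A)\<^sup>\<star> = - A\<^sup>\<star>"
    "(scale_op c A)\<^sup>\<star> = scale_op (cnj c) (A\<^sup>\<star>)" "(r *\<^sub>R A)\<^sup>\<star> = r *\<^sub>R A\<^sup>\<star>" "(A\<^sup>\<star>)\<^sup>\<star> = A"
  using assms adj_algebra(3,5)[of A A] by (simp_all add: adj_algebra adj_involution scaleR_scale_op)

lemma adj_zero [simp]: "0\<^sup>\<star> = (0 :: 'h \<Rightarrow>\<^sub>L 'h)"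
  using adj_mem_simps(2)[OF id_mem id_mem] by simp

lemma adj_eq_0_iff: "A \<in> M \<Longrightarrow> A\<^sup>\<star> = 0 \<longleftrightarrow> A = 0"
  by (metis adj_mem_simps(7) adj_zero)

lemma inner_self_adjoint: "A \<in> M \<Longrightarrow> A\<^sup>\<star> = A \<Longrightarrow> inner (A x) y = inner x (A y)"
  using inner_adj[of A x y] by simp

lemma compose_adj_eq_0_iff: "A \<in> M \<Longrightarrow> A \<cdot> A\<^sup>\<star> = 0 \<longleftrightarrow> A = 0"
proof
  assume A: "A \<in> M" and "A \<cdot> A\<^sup>\<star> = 0"
  then have "inner (A\<^sup>\<star> x) (A\<^sup>\<star> x) = 0" for x
    using inner_adj[of A "A\<^sup>\<star> x" x]
    by (simp flip: blinfun_apply_blinfun_compose)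
  then have "A\<^sup>\<star> = 0"
    by (intro blinfun_eqI) simp
  then show "A = 0"
    using A by (simp add: adj_eq_0_iff)
qed (simp add: compose_distribs)

end

lemma norm_blinfun_le_iff: "0 \<le> c \<Longrightarrow> norm A \<le> c \<longleftrightarrow> (\<forall>x. norm (blinfun_apply A x) \<le> c * norm x)"
  by (metis mult_right_mono norm_blinfun norm_blinfun_bound norm_ge_zero order_trans)

lemma contraction_apply: "norm A \<le> 1 \<Longrightarrow> norm (blinfun_apply A x) \<le> norm x"
  using norm_blinfun_le_iff[of 1 A] by simp

context operator_star_algebra
begin

lemma norm_id_minus_square:
  assumes "T \<in> M" "T\<^sup>\<star> = T"
  shows "(norm ((id_blinfun - T \<cdot> T) x))\<^sup>2 = (norm x)\<^sup>2 - 2 * (norm (T x))\<^sup>2 + (norm (T (T x)))\<^sup>2"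
proof -
  have "inner x (T (T x)) = inner (T x) (T x)"
    by (simp add: inner_self_adjoint[OF assms])
  then show ?thesis
    unfolding power2_norm_eq_inner
    by (simp add: blinfun.bilinear_simps inner_diff_left inner_diff_right inner_commute)
qed

lemma id_minus_square_contraction:
  assumes T: "T \<in> M" "T\<^sup>\<star> = T" and le: "norm T \<le> 1"
  shows "norm (id_blinfun - T \<cdot> T) \<le> 1"
proof -
  have "norm ((id_blinfun - T \<cdot> T) x) \<le> norm x" for x
  proof (rule power2_le_imp_le)
    have "(norm (T (T x)))\<^sup>2 \<le> (norm (T x))\<^sup>2"
      by (intro power_mono contraction_apply le) simp
    then show "(norm ((id_blinfun - T \<cdot> T) x))\<^sup>2 \<le> (norm x)\<^sup>2"
      unfolding norm_id_minus_square[OF T] using zero_le_power2[of "norm (T x)"] by linarith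
  qed simp
  then show ?thesis
    by (simp add: norm_blinfun_le_iff)
qed

end

section \<open>Strong limits, kernels and square roots in von Neumann algebras\<close>

locale von_neumann = operator_star_algebra M
  for M :: "('h::complex_hilbert_space \<Rightarrow>\<^sub>L 'h) set" +
  assumes wot_closed: "closedin weak_operator_topology M"
begin

text \<open>
  Strong convergence of a sequence implies its convergence in the weak operator topology, which is
  all the topological information on \<open>M\<close> that the limits constructed below require.
\<close>

lemma strong_limit_mem:
  assumes S: "\<And>n. S n \<in> M" and lim: "\<And>x. (\<lambda>n. blinfun_apply (S n) x) \<longlonglongrightarrow> blinfun_apply E x"
  shows "E \<in> M"
proof (rule ccontr)
  assume notin: "E \<notin> M"
  define f :: "('h \<Rightarrow>\<^sub>L 'h) \<Rightarrow> 'h \<times> 'h \<Rightarrow> complex" where "f A = (\<lambda>(x, y). cinner (A x) y)" for A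
  have wot: "weak_operator_topology = pullback_topology bounded_ops f euclidean"
    by (simp add: weak_operator_topology_def f_def[abs_def])
  have top: "topspace weak_operator_topology = (bounded_ops :: ('h \<Rightarrow>\<^sub>L 'h) set)"
    by (simp add: wot topspace_pullback_topology)
  have E: "E \<in> bounded_ops"
  proof -
    have "E (c *\<^sub>C x) = c *\<^sub>C E x" for c x
    proof (rule LIMSEQ_unique)
      show "(\<lambda>n. S n (c *\<^sub>C x)) \<longlonglongrightarrow> E (c *\<^sub>C x)" by (rule lim)
      show "(\<lambda>n. S n (c *\<^sub>C x)) \<longlonglongrightarrow> c *\<^sub>C E x"
        using bounded_linear.tendsto[OF bounded_linear_scaleC lim]
        by (simp add: bounded_opsD[OF bounded_opsI[OF S]])
    qed
    then show ?thesis by (simp add: bounded_ops_def)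
  qed
  have "openin weak_operator_topology (bounded_ops - M)"
    using wot_closed by (simp add: closedin_def top)
  then obtain U where U: "open U" "bounded_ops - M = f -` U \<inter> bounded_ops"
    by (auto simp: wot openin_pullback_topology)
  have "(\<lambda>n. f (S n) z) \<longlonglongrightarrow> f E z" for z
  proof -
    obtain x y where z: "z = (x, y)" by (cases z)
    have c: "cinner u v = Complex (inner u v) (- inner (\<i> *\<^sub>C u) v)" for u v :: 'h
      by (rule complex_eqI) (simp_all add: inner_eq_Re_cinner cinner_scaleC_left)
    have "(\<lambda>n. Complex (inner (S n x) y) (- inner (\<i> *\<^sub>C S n x) y))
        \<longlonglongrightarrow> Complex (inner (E x) y) (- inner (\<i> *\<^sub>C E x) y)"
      by (intro tendsto_intros lim bounded_linear.tendsto[OF bounded_linear_scaleC])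
    then show ?thesis
      by (simp add: z f_def c)
  qed
  then have lim_f: "(\<lambda>n. f (S n)) \<longlonglongrightarrow> f E"
    by (simp add: limitin_componentwise flip: limitin_canonical_iff euclidean_product_topology)
  have "f E \<in> U"
    using U(2) E notin by auto
  from topological_tendstoD[OF lim_f U(1) this]
  obtain n where "f (S n) \<in> U"
    by (auto simp: eventually_sequentially)
  then have "S n \<in> bounded_ops - M"
    using U(2) S by auto
  with S show False by blast
qed

lemma norm_limit_mem: "(\<And>n. S n \<in> M) \<Longrightarrow> S \<longlonglongrightarrow> E \<Longrightarrow> E \<in> M"
  by (rule strong_limit_mem[of S]) (auto intro: blinfun.tendsto[OF _ tendsto_const])

text \<open>
  The powers of a self-adjoint contraction \<open>S\<close> satisfy
  \<open>\<parallel>S\<^bsup>2m\<^esup>x - S\<^bsup>2n\<^esup>x\<parallel>\<^sup>2 = a (2m) + a (2n) - 2 a (m + n)\<close> with the decreasing sequence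
  \<open>a k = \<parallel>S\<^bsup>k\<^esup>x\<parallel>\<^sup>2\<close>, so the even powers converge strongly; the limit projects onto the
  fixed space of \<open>S\<^sup>2\<close>.
\<close>

lemma fixed_space_projection:
  assumes S: "S \<in> M" "S\<^sup>\<star> = S" and contr: "norm S \<le> 1"
  shows "\<exists>E\<in>M. projection E \<and> (\<forall>x. E x = x \<longleftrightarrow> S (S x) = x)"
proof -
  define s where "s n = ((\<cdot>) S ^^ n) id_blinfun" for n
  have s_simps [simp]: "s 0 = id_blinfun" "s (Suc n) = S \<cdot> s n" for n
    by (simp_all add: s_def)
  have s_mem: "s n \<in> M" for n
    by (induction n) (auto simp: S)
  have s_shift: "s n (S x) = S (s n x)" for n x
    by (induction n arbitrary: x) auto
  have s_add: "inner (s m x) (s n y) = inner x (s (m + n) y)" for m n x y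
  proof (induction m arbitrary: n)
    case (Suc m)
    have "inner (s (Suc m) x) (s n y) = inner (s m x) (s (Suc n) y)"
      by (simp add: inner_self_adjoint[OF S])
    then show ?case
      using Suc.IH[of "Suc n"] by simp
  qed simp
  have s_self_adj: "inner (s m x) y = inner x (s m y)" for m x y
    using s_add[of m x 0 y] by simp
  have s_norm: "norm (s (Suc n) x) \<le> norm (s n x)" for n x
    by (simp add: contraction_apply contr)
  have s_contr: "norm (s n x) \<le> norm x" for n x
    by (induction n) (auto intro: order_trans[OF s_norm] simp del: s_simps(2))
  have Cauchy_s: "Cauchy (\<lambda>n. s (2 * n) x)" for x
  proof -
    define a where "a n = (norm (s n x))\<^sup>2" for n
    have "decseq a"
      unfolding a_def by (intro decseq_SucI power_mono s_norm) simp
    moreover have "0 \<le> a n" for n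
      by (simp add: a_def)
    ultimately have "convergent a"
      by (metis convergentI decseq_convergent)
    then have "Cauchy a"
      by (rule convergent_Cauchy)
    have dist_a: "(norm (s (2 * m) x - s (2 * n) x))\<^sup>2 = (a (2 * m) - a (m + n)) + (a (2 * n) - a (m + n))"
      for m n
    proof -
      have "inner (s (2 * m) x) (s (2 * n) x) = inner (s (m + n) x) (s (m + n) x)"
        by (simp add: s_add mult_2 add_ac)
      then show ?thesis
        unfolding a_def power2_norm_eq_inner
        by (simp add: inner_diff_left inner_diff_right inner_commute)
    qed
    show ?thesis
    proof (rule metric_CauchyI)
      fix e :: real assume e: "0 < e"
      then have "0 < e\<^sup>2 / 2" by simp
      then obtain N where N: "\<And>m n. N \<le> m \<Longrightarrow> N \<le> n \<Longrightarrow> dist (a m) (a n) < e\<^sup>2 / 2"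
        using metric_CauchyD[OF \<open>Cauchy a\<close>] by blast
      have "dist (s (2 * m) x) (s (2 * n) x) < e" if "N \<le> m" "N \<le> n" for m n
      proof -
        have "\<bar>a (2 * m) - a (m + n)\<bar> < e\<^sup>2 / 2" "\<bar>a (2 * n) - a (m + n)\<bar> < e\<^sup>2 / 2"
          using N[of "2 * m" "m + n"] N[of "2 * n" "m + n"] that by (auto simp: dist_real_def)
        then have "(norm (s (2 * m) x - s (2 * n) x))\<^sup>2 < e\<^sup>2"
          unfolding dist_a by linarith
        then show ?thesis
          using e by (simp add: dist_norm power2_less_imp_less)
      qed
      then show "\<exists>N. \<forall>m\<ge>N. \<forall>n\<ge>N. dist (s (2 * m) x) (s (2 * n) x) < e" by blast
    qed
  qed
  define L where "L x = lim (\<lambda>n. s (2 * n) x)" for x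
  have L: "(\<lambda>n. s (2 * n) x) \<longlonglongrightarrow> L x" for x
    using Cauchy_s[of x] by (simp add: L_def Cauchy_convergent_iff convergent_LIMSEQ_iff)
  have "bounded_linear L"
  proof (rule bounded_linear_intro)
    show "L (x + y) = L x + L y" for x y
      using L[of "x + y"] tendsto_add[OF L[of x] L[of y]]
      by (simp add: blinfun.add_right LIMSEQ_unique)
    show "L (r *\<^sub>R x) = r *\<^sub>R L x" for r x
      using L[of "r *\<^sub>R x"] tendsto_scaleR[OF tendsto_const L[of x], of r]
      by (simp add: blinfun.scaleR_right LIMSEQ_unique)
    show "norm (L x) \<le> norm x * 1" for x
      using LIMSEQ_le_const2[OF tendsto_norm[OF L]] s_contr by auto
  qed
  then obtain E where "blinfun_apply E = L"
    using bounded_linear_Blinfun_apply by blast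
  with L have E: "(\<lambda>n. s (2 * n) x) \<longlonglongrightarrow> E x" for x
    by simp
  have E_mem: "E \<in> M"
    by (rule strong_limit_mem[of "\<lambda>n. s (2 * n)"]) (auto simp: s_mem E)
  have SSE: "S (S (E x)) = E x" for x
  proof (rule LIMSEQ_unique)
    show "(\<lambda>n. s (2 * Suc n) x) \<longlonglongrightarrow> E x"
      by (rule LIMSEQ_Suc[OF E])
    show "(\<lambda>n. s (2 * Suc n) x) \<longlonglongrightarrow> S (S (E x))"
      using blinfun.tendsto[OF tendsto_const blinfun.tendsto[OF tendsto_const E]] by simp
  qed
  have fix_E: "E x = x" if "S (S x) = x" for x
  proof -
    have "s (2 * n) x = x" for n
      by (induction n) (simp_all add: that)
    then show ?thesis
      using E[of x] by (simp add: LIMSEQ_const_iff)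
  qed
  have "E\<^sup>\<star> = E"
  proof (rule adj_eqI)
    show "inner (E x) y = inner x (E y)" for x y
    proof (rule LIMSEQ_unique)
      show "(\<lambda>n. inner (s (2 * n) x) y) \<longlonglongrightarrow> inner (E x) y"
        by (intro tendsto_intros E)
      show "(\<lambda>n. inner (s (2 * n) x) y) \<longlonglongrightarrow> inner x (E y)"
        unfolding s_self_adj by (intro tendsto_intros E)
    qed
  qed (simp add: E_mem)
  moreover have "E \<cdot> E = E"
    by (rule blinfun_eqI) (simp add: fix_E SSE)
  ultimately have "projection E"
    by (simp add: projection_def)
  moreover have "\<forall>x. E x = x \<longleftrightarrow> S (S x) = x"
    using SSE fix_E by metis
  ultimately show ?thesis
    using E_mem by blast
qed

text \<open>
  After scaling, \<open>T\<close> is a contraction, and its kernel is the fixed space of \<open>(1 - T\<^sup>2)\<^sup>2\<close>: a vector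
  on which the contraction \<open>1 - T\<^sup>2\<close> preserves the norm is killed by \<open>T\<close>.
\<close>

lemma kernel_projection:
  assumes T: "T \<in> M" "T\<^sup>\<star> = T"
  shows "\<exists>E\<in>M. projection E \<and> T \<cdot> E = 0 \<and> (\<forall>x. T x = 0 \<longrightarrow> E x = x)"
proof -
  define c where "c = inverse (norm T + 1)"
  have c: "c > 0" by (simp add: c_def add_nonneg_pos)
  define T' where "T' = c *\<^sub>R T"
  have T': "T' \<in> M" "T'\<^sup>\<star> = T'" and T'_0: "T' x = 0 \<longleftrightarrow> T x = 0" for x
    using T c by (auto simp: T'_def blinfun.bilinear_simps)
  have T'_contr: "norm T' \<le> 1"
    using add_nonneg_pos[OF norm_ge_zero[of T] zero_less_one] by (simp add: T'_def c_def divide_simps)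
  define S where "S = id_blinfun - T' \<cdot> T'"
  have S: "S \<in> M" "S\<^sup>\<star> = S"
    using T' by (simp_all add: S_def adj_id)
  have S_contr: "norm S \<le> 1"
    unfolding S_def by (rule id_minus_square_contraction[OF T' T'_contr])
  obtain E where E: "E \<in> M" "projection E" "\<And>x. E x = x \<longleftrightarrow> S (S x) = x"
    using fixed_space_projection[OF S S_contr] by blast
  have "T (E x) = 0" for x
  proof -
    define z where "z = E x"
    have "E z = z"
      using E(2) by (metis blinfun_apply_blinfun_compose projection_def z_def)
    then have "norm z \<le> norm (S z)"
      using E(3) contraction_apply[OF S_contr] by metis
    then have "(norm z)\<^sup>2 \<le> (norm (S z))\<^sup>2"
      by (intro power_mono) auto
    also have "\<dots> = (norm z)\<^sup>2 - 2 * (norm (T' z))\<^sup>2 + (norm (T' (T' z)))\<^sup>2"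
      unfolding S_def by (rule norm_id_minus_square[OF T'])
    also have "(norm (T' (T' z)))\<^sup>2 \<le> (norm (T' z))\<^sup>2"
      by (intro power_mono contraction_apply T'_contr) simp
    finally show ?thesis
      by (simp add: T'_0 flip: z_def)
  qed
  then have "T \<cdot> E = 0"
    by (intro blinfun_eqI) simp
  moreover have "E x = x" if "T x = 0" for x
    using that T'_0[of x] by (simp add: E(3) S_def blinfun.bilinear_simps)
  ultimately show ?thesis
    using E by blast
qed

text \<open>
  With \<open>X = 1 - S\<close>, the root is \<open>1 - Y\<close> for the solution of \<open>Y = (X + Y\<^sup>2) / 2\<close> found by
  iteration from \<open>0\<close>.  The increments of the iteration are dominated by those of the scalar
  iteration \<open>t \<mapsto> (1 + t\<^sup>2) / 2\<close>, which increases to \<open>1\<close>; hence it converges in norm.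
\<close>

lemma square_root:
  assumes S: "S \<in> M" "S\<^sup>\<star> = S" and le: "norm (id_blinfun - S) \<le> 1"
  shows "\<exists>V\<in>M. V\<^sup>\<star> = V \<and> V \<cdot> V = S \<and> norm (id_blinfun - V) \<le> 1 \<and>
    (\<forall>B. B \<cdot> S = S \<cdot> B \<longrightarrow> B \<cdot> V = V \<cdot> B)"
proof -
  define X where "X = id_blinfun - S"
  have X: "X \<in> M" "X\<^sup>\<star> = X" "norm X \<le> 1"
    using S le by (simp_all add: X_def adj_id)
  define Y where "Y = rec_nat 0 (\<lambda>_ Z. (1/2) *\<^sub>R (X + Z \<cdot> Z))"
  have Y [simp]: "Y 0 = 0" "Y (Suc n) = (1/2) *\<^sub>R (X + Y n \<cdot> Y n)" for n
    by (simp_all add: Y_def)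
  define y where "y = rec_nat 0 (\<lambda>_ t. (1 + t\<^sup>2) / (2::real))"
  have y [simp]: "y 0 = 0" "y (Suc n) = (1 + (y n)\<^sup>2) / 2" for n
    by (simp_all add: y_def)
  have y_bounds: "0 \<le> y n \<and> y n \<le> 1" for n
    by (induction n) (auto simp: power_le_one)
  have y_inc: "y n \<le> y (Suc n)" for n
    using zero_le_power2[of "1 - y n"] by (simp add: power2_eq_square algebra_simps)
  have Y_mem: "Y n \<in> M" for n
    by (induction n) (auto simp: X)
  have Y_adj: "(Y n)\<^sup>\<star> = Y n" for n
    by (induction n) (simp_all add: X Y_mem)
  have norm_Y: "norm (Y n) \<le> y n" for n
  proof (induction n)
    case (Suc n)
    have "norm (Y n \<cdot> Y n) \<le> norm (Y n) * norm (Y n)"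
      by (rule norm_blinfun_compose)
    also have "\<dots> \<le> y n * y n"
      using Suc y_bounds by (intro mult_mono) auto
    finally have "norm (X + Y n \<cdot> Y n) \<le> 1 + (y n)\<^sup>2"
      using X(3) norm_triangle_ineq[of X "Y n \<cdot> Y n"] by (simp add: power2_eq_square)
    then show ?case by simp
  qed simp
  have diff_Y: "(1/2) *\<^sub>R (X + U \<cdot> U) - (1/2) *\<^sub>R (X + Z \<cdot> Z) = (1/2) *\<^sub>R (U \<cdot> (U - Z) + (U - Z) \<cdot> Z)"
    for U Z
    by (simp add: compose_distribs scaleR_add_right scaleR_diff_right)
  have diff_y: "(1 + u\<^sup>2) / 2 - (1 + z\<^sup>2) / 2 = (u * (u - z) + (u - z) * z) / 2" for u z :: real
    by (simp add: field_simps power2_eq_square)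
  have incr: "norm (Y (Suc n) - Y n) \<le> y (Suc n) - y n" for n
  proof (induction n)
    case 0
    then show ?case using X(3) by (simp add: compose_distribs)
  next
    case (Suc n)
    let ?d = "Y (Suc n) - Y n" and ?e = "y (Suc n) - y n"
    have "norm (Y (Suc n) \<cdot> ?d) \<le> norm (Y (Suc n)) * norm ?d"
      by (rule norm_blinfun_compose)
    also have "\<dots> \<le> y (Suc n) * ?e"
      by (rule mult_mono[OF norm_Y Suc]) (use y_bounds in \<open>auto simp del: y Y\<close>)
    finally have 1: "norm (Y (Suc n) \<cdot> ?d) \<le> y (Suc n) * ?e" .
    have "norm (?d \<cdot> Y n) \<le> norm ?d * norm (Y n)"
      by (rule norm_blinfun_compose)
    also have "\<dots> \<le> ?e * y n"
      by (rule mult_mono[OF Suc norm_Y]) (use y_inc[of n] in \<open>auto simp del: y Y\<close>)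
    finally have 2: "norm (?d \<cdot> Y n) \<le> ?e * y n" .
    have "norm (Y (Suc (Suc n)) - Y (Suc n)) = norm ((1/2) *\<^sub>R (Y (Suc n) \<cdot> ?d + ?d \<cdot> Y n))"
      using diff_Y[of "Y (Suc n)" "Y n"] unfolding Y(2)[symmetric] by (rule arg_cong)
    also have "\<dots> = (1/2) * norm (Y (Suc n) \<cdot> ?d + ?d \<cdot> Y n)"
      by simp
    also have "\<dots> \<le> (1/2) * (y (Suc n) * ?e + ?e * y n)"
      by (intro mult_left_mono norm_triangle_le add_mono 1 2) simp
    also have "\<dots> = y (Suc (Suc n)) - y (Suc n)"
      using diff_y[of "y (Suc n)" "y n"] unfolding y(2)[symmetric] by simp
    finally show ?case .
  qed
  have dominated: "norm (Y (n + k) - Y n) \<le> y (n + k) - y n" for n k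
  proof (induction k)
    case (Suc k)
    have "norm (Y (n + Suc k) - Y n) \<le> norm (Y (Suc (n + k)) - Y (n + k)) + norm (Y (n + k) - Y n)"
      using norm_triangle_ineq[of "Y (Suc (n + k)) - Y (n + k)" "Y (n + k) - Y n"] by (simp del: Y)
    then show ?case
      using incr[of "n + k"] Suc by (simp del: Y y)
  qed simp
  have "convergent y"
    using y_bounds y_inc by (intro Bseq_monoseq_convergent BseqI'[of _ 1] incseq_imp_monoseq incseq_SucI)
      (auto simp: abs_of_nonneg simp del: y)
  then have "Cauchy y"
    by (rule convergent_Cauchy)
  have "Cauchy Y"
  proof (rule CauchyI')
    fix e :: real assume "0 < e"
    then obtain N where N: "\<And>m n. N \<le> m \<Longrightarrow> N \<le> n \<Longrightarrow> norm (y m - y n) < e"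
      using CauchyD[OF \<open>Cauchy y\<close>] by blast
    have "norm (Y m - Y n) < e" if "N \<le> m" "m < n" for m n
      using dominated[of m "n - m"] N[of n m] that by (simp add: norm_minus_commute)
    then show "\<exists>N. \<forall>m\<ge>N. \<forall>n>m. dist (Y m) (Y n) < e" by (auto simp: dist_norm)
  qed
  then obtain L where L: "Y \<longlonglongrightarrow> L"
    by (auto simp: Cauchy_convergent_iff convergent_def)
  note tendsto_compose = bounded_bilinear.tendsto[OF bounded_bilinear_blinfun_compose]
  have L_mem: "L \<in> M"
    by (rule norm_limit_mem[OF Y_mem L])
  have "(\<lambda>n. Y (Suc n)) \<longlonglongrightarrow> (1/2) *\<^sub>R (X + L \<cdot> L)"
    unfolding Y by (intro tendsto_intros tendsto_compose L)
  then have fixpoint: "L = (1/2) *\<^sub>R (X + L \<cdot> L)"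
    using LIMSEQ_Suc[OF L] by (rule LIMSEQ_unique[rotated])
  have L_adj: "L\<^sup>\<star> = L"
  proof (rule adj_eqI)
    show "inner (L x) z = inner x (L z)" for x z
    proof (rule LIMSEQ_unique)
      show "(\<lambda>n. inner (Y n x) z) \<longlonglongrightarrow> inner (L x) z"
        by (intro tendsto_intros blinfun.tendsto L)
      show "(\<lambda>n. inner (Y n x) z) \<longlonglongrightarrow> inner x (L z)"
        unfolding inner_self_adjoint[OF Y_mem Y_adj] by (intro tendsto_intros blinfun.tendsto L)
    qed
  qed (simp add: L_mem)
  have L_norm: "norm L \<le> 1"
    using LIMSEQ_le_const2[OF tendsto_norm[OF L]] norm_Y y_bounds by (meson order_trans)
  have L_comm: "B \<cdot> L = L \<cdot> B" if "B \<cdot> S = S \<cdot> B" for B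
  proof (rule LIMSEQ_unique)
    have BX: "B \<cdot> X = X \<cdot> B"
      using that by (simp add: X_def compose_distribs)
    have BY: "B \<cdot> Y n = Y n \<cdot> B" for n
    proof (induction n)
      case (Suc n)
      have "B \<cdot> (Y n \<cdot> Y n) = Y n \<cdot> Y n \<cdot> B"
        by (metis Suc compose_assoc)
      then show ?case by (simp add: compose_distribs BX)
    qed (simp add: compose_distribs)
    show "(\<lambda>n. B \<cdot> Y n) \<longlonglongrightarrow> B \<cdot> L"
      by (intro tendsto_compose tendsto_const L)
    show "(\<lambda>n. B \<cdot> Y n) \<longlonglongrightarrow> L \<cdot> B"
      unfolding BY by (intro tendsto_compose tendsto_const L)
  qed
  define V where "V = id_blinfun - L"
  have "2 *\<^sub>R L = 2 *\<^sub>R ((1/2) *\<^sub>R (X + L \<cdot> L))"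
    using fixpoint by simp
  then have "L + L = X + L \<cdot> L"
    by (simp add: scaleR_2)
  then have "V \<cdot> V = S"
    by (simp add: V_def X_def compose_distribs algebra_simps)
  moreover have "V \<in> M" "V\<^sup>\<star> = V" "norm (id_blinfun - V) \<le> 1"
    using L_mem L_adj L_norm by (simp_all add: V_def adj_id)
  moreover have "B \<cdot> V = V \<cdot> B" if "B \<cdot> S = S \<cdot> B" for B
    using L_comm[OF that] by (simp add: V_def compose_distribs)
  ultimately show ?thesis by blast
qed

text \<open>
  Here \<open>D = \<bar>B\<bar>\<close>, and \<open>E\<close> is the projection onto the kernel of \<open>\<bar>B\<bar> - B\<close>, so that
  \<open>2E - 1\<close> is a sign of \<open>B\<close>.  The bound says \<open>0 \<le> \<bar>B\<bar> \<le> 1\<close>; it follows from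
  \<open>\<bar>B\<bar>\<^sup>2 \<le> \<bar>B\<bar>\<close>, seen through a square root of \<open>\<bar>B\<bar>\<close>.
\<close>

lemma sign_decomposition:
  assumes B: "B \<in> M" "B\<^sup>\<star> = B" and B_contr: "norm B \<le> 1"
  shows "\<exists>D\<in>M. \<exists>E\<in>M. D\<^sup>\<star> = D \<and> projection E \<and> B = (E + E - id_blinfun) \<cdot> D \<and>
    norm (D - (1/2) *\<^sub>R id_blinfun) \<le> 1/2"
proof -
  have BB: "B \<cdot> B \<in> M" "(B \<cdot> B)\<^sup>\<star> = B \<cdot> B"
    using B by simp_all
  obtain D where D: "D \<in> M" "D\<^sup>\<star> = D" "D \<cdot> D = B \<cdot> B" "norm (id_blinfun - D) \<le> 1"
    and "\<forall>C. C \<cdot> (B \<cdot> B) = B \<cdot> B \<cdot> C \<longrightarrow> C \<cdot> D = D \<cdot> C"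
    using square_root[OF BB id_minus_square_contraction[OF B B_contr]] by blast
  then have BD: "B \<cdot> D = D \<cdot> B"
    by (simp add: compose_assoc)
  obtain V where V: "V \<in> M" "V\<^sup>\<star> = V" "V \<cdot> V = D"
    using square_root[OF D(1,2,4)] by blast
  have D_contr: "norm (D x) \<le> norm x" for x
  proof -
    have "inner (D x) (D x) = inner ((D \<cdot> D) x) x"
      by (simp add: inner_self_adjoint[OF D(1,2)])
    also have "\<dots> = inner (B x) (B x)"
      by (simp add: D(3) inner_self_adjoint[OF B])
    finally have "norm (D x) = norm (B x)"
      by (simp add: norm_eq_sqrt_inner)
    then show ?thesis
      using contraction_apply[OF B_contr, of x] by simp
  qed
  have V_D: "(norm (V x))\<^sup>2 = inner (D x) x" for x
    by (simp add: power2_norm_eq_inner inner_self_adjoint[OF V(1,2)] inner_commute flip: V(3))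
  have V_contr: "(norm (V x))\<^sup>2 \<le> (norm x)\<^sup>2" for x
  proof -
    have "inner (D x) x \<le> norm (D x) * norm x"
      by (rule norm_cauchy_schwarz)
    also have "\<dots> \<le> norm x * norm x"
      by (intro mult_right_mono D_contr) simp
    finally show ?thesis
      unfolding V_D by (simp add: power2_eq_square)
  qed
  have "norm ((D - (1/2) *\<^sub>R id_blinfun) x) \<le> 1/2 * norm x" for x
  proof (rule power2_le_imp_le)
    have "D x = V (V x)"
      by (simp flip: V(3))
    then have "(norm (D x))\<^sup>2 \<le> inner (D x) x"
      using V_contr[of "V x"] V_D[of x] by simp
    then show "(norm ((D - (1/2) *\<^sub>R id_blinfun) x))\<^sup>2 \<le> (1/2 * norm x)\<^sup>2"
      unfolding power2_norm_eq_inner power_mult_distrib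
      by (simp add: blinfun.bilinear_simps inner_diff_left inner_diff_right inner_commute
          power2_eq_square)
  qed simp
  then have D_half: "norm (D - (1/2) *\<^sub>R id_blinfun) \<le> 1/2"
    by (subst norm_blinfun_le_iff) simp_all
  have "D - B \<in> M" "(D - B)\<^sup>\<star> = D - B"
    using B D by simp_all
  then obtain E where E: "E \<in> M" "projection E" "(D - B) \<cdot> E = 0"
    and E_fix: "\<And>x. (D - B) x = 0 \<Longrightarrow> E x = x"
    using kernel_projection by blast
  have "(D - B) \<cdot> (D + B) = 0"
    using BD D(3) by (simp add: compose_distribs)
  then have "E \<cdot> (D + B) = D + B"
    by (intro blinfun_eqI)
       (metis E_fix blinfun_apply_blinfun_compose blinfun.zero_left)
  moreover have "((D - B) \<cdot> E)\<^sup>\<star> = E \<cdot> (D - B)"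
    using E(1,2) B D by (simp add: projection_def)
  then have "E \<cdot> (D - B) = 0"
    using E(3) by simp
  ultimately have "B = (E + E - id_blinfun) \<cdot> D"
    by (simp add: compose_distribs algebra_simps)
  then show ?thesis
    using D(1,2) E(1,2) D_half by blast
qed

end

section \<open>Projections detect commutativity\<close>

context von_neumann
begin

text \<open>
  The sign decomposition \<open>B = (2E - 1) D\<close> turns a commutator with \<open>B\<close> into one with \<open>D - 1/2\<close>,
  whose norm is at most \<open>1/2\<close>: the scalar \<open>1/2\<close> is central, and on \<open>R\<close> so is the symmetry
  \<open>2E - 1\<close>.  Iterating halves the commutator again and again.
\<close>

lemma commutators_vanish_if_projections_central:
  assumes R: "R \<in> M" "\<And>A. A \<in> M \<Longrightarrow> R \<cdot> A = A \<cdot> R"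
    and central: "\<And>P A. P \<in> M \<Longrightarrow> projection P \<Longrightarrow> A \<in> M \<Longrightarrow> P \<cdot> A \<cdot> R = A \<cdot> P \<cdot> R"
    and A: "A \<in> M" and B: "B \<in> M"
  shows "B \<cdot> A \<cdot> R = A \<cdot> B \<cdot> R"
proof -
  define K where "K = 2 * norm A * norm R"
  have contraction: "norm (B \<cdot> A \<cdot> R - A \<cdot> B \<cdot> R) \<le> K * (1/2) ^ n"
    if "B \<in> M" "B\<^sup>\<star> = B" "norm B \<le> 1" for B n
    using that
  proof (induction n arbitrary: B)
    case 0
    have "norm (B \<cdot> A \<cdot> R) \<le> norm B * norm A * norm R"
      by (intro order_trans[OF norm_blinfun_compose] mult_right_mono norm_blinfun_compose) simp
    moreover have "norm (A \<cdot> B \<cdot> R) \<le> norm A * norm B * norm R"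
      by (intro order_trans[OF norm_blinfun_compose] mult_right_mono norm_blinfun_compose) simp
    moreover have "norm B * (norm A * norm R) \<le> 1 * (norm A * norm R)"
      by (intro mult_right_mono 0) simp
    ultimately show ?case
      using norm_triangle_ineq4[of "B \<cdot> A \<cdot> R" "A \<cdot> B \<cdot> R"] by (simp add: K_def mult_ac)
  next
    case (Suc n)
    obtain D E where D: "D \<in> M" "D\<^sup>\<star> = D" "norm (D - (1/2) *\<^sub>R id_blinfun) \<le> 1/2"
      and E: "E \<in> M" "projection E" and B_eq: "B = (E + E - id_blinfun) \<cdot> D"
      using sign_decomposition[OF Suc.prems] by blast
    define U where "U = E + E - id_blinfun"
    have U: "U \<in> M" "U\<^sup>\<star> = U" "U \<cdot> U = id_blinfun"
      using E by (simp_all add: U_def projection_def adj_id compose_distribs)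
    have "norm (U x) = norm x" for x
    proof -
      have "inner (U x) (U x) = inner x ((U \<cdot> U) x)"
        by (simp add: inner_self_adjoint[OF U(1,2)])
      then show ?thesis
        by (simp add: U(3) norm_eq_sqrt_inner)
    qed
    then have U_norm: "norm U \<le> 1"
      by (simp add: norm_blinfun_le_iff)
    define B' where "B' = 2 *\<^sub>R (D - (1/2) *\<^sub>R id_blinfun)"
    have B': "B' \<in> M" "B'\<^sup>\<star> = B'" "norm B' \<le> 1"
      using D by (simp_all add: B'_def adj_id)
    have D_eq: "D = (1/2) *\<^sub>R (B' + id_blinfun)"
      by (simp add: B'_def scaleR_add_right scaleR_diff_right)
    have "A \<cdot> U \<cdot> R = U \<cdot> A \<cdot> R"
      using central[OF E A] by (simp add: U_def compose_distribs)
    then have "A \<cdot> (U \<cdot> (R \<cdot> D)) = U \<cdot> (A \<cdot> (R \<cdot> D))"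
      by (metis compose_assoc)
    then have "A \<cdot> B \<cdot> R = U \<cdot> (A \<cdot> (D \<cdot> R))"
      by (simp add: B_eq compose_assoc R(2)[OF D(1)] flip: U_def)
    then have "B \<cdot> A \<cdot> R - A \<cdot> B \<cdot> R = U \<cdot> (D \<cdot> A \<cdot> R - A \<cdot> D \<cdot> R)"
      by (simp add: B_eq compose_simps flip: U_def)
    also have "D \<cdot> A \<cdot> R - A \<cdot> D \<cdot> R = (1/2) *\<^sub>R (B' \<cdot> A \<cdot> R - A \<cdot> B' \<cdot> R)"
      by (simp add: D_eq compose_simps scaleR_add_right scaleR_diff_right)
    finally have eq: "B \<cdot> A \<cdot> R - A \<cdot> B \<cdot> R = U \<cdot> ((1/2) *\<^sub>R (B' \<cdot> A \<cdot> R - A \<cdot> B' \<cdot> R))" .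
    have "norm (B \<cdot> A \<cdot> R - A \<cdot> B \<cdot> R) \<le> norm U * norm ((1/2) *\<^sub>R (B' \<cdot> A \<cdot> R - A \<cdot> B' \<cdot> R))"
      unfolding eq by (rule norm_blinfun_compose)
    also have "\<dots> \<le> 1 * ((1/2) * (K * (1/2) ^ n))"
      using Suc.IH[OF B'] U_norm by (intro mult_mono) auto
    finally show ?case by simp
  qed
  have self_adjoint: "B \<cdot> A \<cdot> R = A \<cdot> B \<cdot> R" if B: "B \<in> M" "B\<^sup>\<star> = B" for B
  proof -
    define c where "c = inverse (norm B + 1)"
    have pos: "norm B + 1 > 0"
      by (simp add: add_nonneg_pos)
    then have c: "c > 0" "norm (c *\<^sub>R B) \<le> 1"
      by (simp_all add: c_def divide_simps)
    have le: "norm (c *\<^sub>R B \<cdot> A \<cdot> R - A \<cdot> (c *\<^sub>R B) \<cdot> R) \<le> K * (1/2) ^ n" for n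
      by (rule contraction) (use B c(2) in simp_all)
    have "(\<lambda>n. K * (1/2) ^ n) \<longlonglongrightarrow> K * 0"
      by (intro tendsto_intros) auto
    then have "norm (c *\<^sub>R B \<cdot> A \<cdot> R - A \<cdot> (c *\<^sub>R B) \<cdot> R) \<le> K * 0"
      by (rule LIMSEQ_le_const) (use le in auto)
    then have "c *\<^sub>R (B \<cdot> A \<cdot> R - A \<cdot> B \<cdot> R) = 0"
      by (simp add: compose_distribs scaleR_diff_right)
    then show ?thesis
      using c(1) by simp
  qed
  have re: "(B + B\<^sup>\<star>) \<cdot> A \<cdot> R = A \<cdot> (B + B\<^sup>\<star>) \<cdot> R"
    using B by (intro self_adjoint) (simp_all add: add.commute)
  have "scale_op \<i> (B - B\<^sup>\<star>) \<cdot> A \<cdot> R = A \<cdot> scale_op \<i> (B - B\<^sup>\<star>) \<cdot> R"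
    using B by (intro self_adjoint) (simp_all add: scale_op_simps)
  then have "scale_op \<i> ((B - B\<^sup>\<star>) \<cdot> A \<cdot> R - A \<cdot> (B - B\<^sup>\<star>) \<cdot> R) = 0"
    using A by (simp add: scale_op_simps compose_scale_op compose_distribs)
  then have im: "(B - B\<^sup>\<star>) \<cdot> A \<cdot> R = A \<cdot> (B - B\<^sup>\<star>) \<cdot> R"
    by (simp add: scale_op_eq_0_iff)
  have "(B + B\<^sup>\<star>) \<cdot> A \<cdot> R + (B - B\<^sup>\<star>) \<cdot> A \<cdot> R = A \<cdot> (B + B\<^sup>\<star>) \<cdot> R + A \<cdot> (B - B\<^sup>\<star>) \<cdot> R"
    by (simp only: re im)
  then have "B \<cdot> A \<cdot> R + B \<cdot> A \<cdot> R = A \<cdot> B \<cdot> R + A \<cdot> B \<cdot> R"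
    by (simp add: compose_distribs algebra_simps)
  then show ?thesis
    by (simp add: double_eq_iff)
qed

text \<open>
  The range projection \<open>R\<close> of \<open>X X\<^sup>*\<close> is annihilated by the same commutators as \<open>X\<close>.  Taking the
  projection \<open>R\<close> itself in the hypothesis shows that \<open>R\<close> is central, and then every projection
  commutes on \<open>R\<close> with all of \<open>M\<close>.  So \<open>R M\<close> is an abelian central summand, and \<open>R = 0\<close>.
\<close>

lemma annihilator_of_projection_commutators:
  assumes no_I1: "no_central_summands_of_type_I 1 M" and X: "X \<in> M"
    and ann: "\<And>P A. P \<in> M \<Longrightarrow> projection P \<Longrightarrow> A \<in> M \<Longrightarrow> (P \<cdot> A - A \<cdot> P) \<cdot> X = 0"
  shows "X = 0"
proof -
  define T where "T = X \<cdot> X\<^sup>\<star>"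
  have T: "T \<in> M" "T\<^sup>\<star> = T"
    using X by (simp_all add: T_def)
  obtain E where E: "E \<in> M" "projection E" "T \<cdot> E = 0" and E_fix: "\<And>x. T x = 0 \<Longrightarrow> E x = x"
    using kernel_projection[OF T] by blast
  define R where "R = id_blinfun - E"
  have R: "R \<in> M" "R\<^sup>\<star> = R" "R \<cdot> R = R"
    using E(1,2) by (simp_all add: R_def projection_def adj_id compose_distribs)
  then have proj_R: "projection R"
    by (simp add: projection_def)
  have ann_R: "(P \<cdot> A - A \<cdot> P) \<cdot> R = 0" if "P \<in> M" "projection P" "A \<in> M" for P A
  proof -
    define G where "G = P \<cdot> A - A \<cdot> P"
    have G: "G \<in> M"
      using that by (simp add: G_def)
    have "G \<cdot> T = 0"
      using ann[OF that] by (simp add: T_def G_def flip: compose_assoc)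
    moreover have "T \<cdot> G\<^sup>\<star> = (G \<cdot> T)\<^sup>\<star>"
      using G T by simp
    ultimately have "T \<cdot> G\<^sup>\<star> = 0"
      by simp
    then have "T (G\<^sup>\<star> x) = 0" for x
      using blinfun_apply_blinfun_compose[of T "G\<^sup>\<star>" x] by (simp add: blinfun.zero_left)
    then have "E \<cdot> G\<^sup>\<star> = G\<^sup>\<star>"
      by (intro blinfun_eqI) (simp add: E_fix)
    then have "(E \<cdot> G\<^sup>\<star>)\<^sup>\<star> = (G\<^sup>\<star>)\<^sup>\<star>"
      by simp
    then have "G \<cdot> E = G"
      using E(1,2) G by (simp add: projection_def)
    then show ?thesis
      by (simp add: R_def compose_distribs flip: G_def)
  qed
  have RAR: "R \<cdot> A \<cdot> R = A \<cdot> R" if "A \<in> M" for A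
    using ann_R[OF R(1) proj_R that] by (simp add: compose_distribs compose_assoc R(3))
  have R_central: "R \<cdot> A = A \<cdot> R" if A: "A \<in> M" for A
  proof -
    have "(R \<cdot> A\<^sup>\<star> \<cdot> R)\<^sup>\<star> = (A\<^sup>\<star> \<cdot> R)\<^sup>\<star>"
      using RAR[of "A\<^sup>\<star>"] A by simp
    then have "R \<cdot> A \<cdot> R = R \<cdot> A"
      using A R by (simp add: compose_assoc)
    then show ?thesis
      using RAR[OF A] by simp
  qed
  have abelian: "B \<cdot> A \<cdot> R = A \<cdot> B \<cdot> R" if "A \<in> M" "B \<in> M" for A B
  proof (rule commutators_vanish_if_projections_central[OF R(1) R_central _ that])
    show "P \<cdot> A \<cdot> R = A \<cdot> P \<cdot> R" if "P \<in> M" "projection P" "A \<in> M" for P A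
      using ann_R[OF that] by (simp add: compose_distribs)
  qed
  let ?N = "central_summand M R"
  have N: "\<exists>A'\<in>M. R \<cdot> A \<cdot> R = A' \<cdot> R" if "A \<in> ?N" for A
  proof -
    obtain A' where "A' \<in> M" "A = A' \<cdot> R"
      using \<open>A \<in> ?N\<close> by (auto simp: central_summand_def)
    then show ?thesis
      using RAR[of A'] by (intro bexI[of _ A']) (simp_all add: compose_assoc R(3))
  qed
  have R_in_N: "R \<in> ?N"
    using R by (auto simp: central_summand_def intro!: exI[of _ R])
  have "(R \<cdot> A \<cdot> R) \<cdot> (R \<cdot> B \<cdot> R) = (R \<cdot> B \<cdot> R) \<cdot> (R \<cdot> A \<cdot> R)" if AB: "A \<in> ?N" "B \<in> ?N" for A B
  proof -
    obtain A' B' where A': "A' \<in> M" "R \<cdot> A \<cdot> R = A' \<cdot> R" and B': "B' \<in> M" "R \<cdot> B \<cdot> R = B' \<cdot> R"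
      using N AB by metis
    have "(A' \<cdot> R) \<cdot> (B' \<cdot> R) = A' \<cdot> B' \<cdot> R"
      by (metis RAR[OF B'(1)] compose_assoc)
    moreover have "(B' \<cdot> R) \<cdot> (A' \<cdot> R) = B' \<cdot> A' \<cdot> R"
      by (metis RAR[OF A'(1)] compose_assoc)
    ultimately show ?thesis
      using abelian[OF A'(1) B'(1)] A'(2) B'(2) by simp
  qed
  then have "abelian_projection ?N R"
    using R_in_N proj_R by (simp add: abelian_projection_def)
  moreover have "equivalent_projections ?N R R"
    unfolding equivalent_projections_def using R_in_N R by (intro bexI[of _ R]) auto
  ultimately have "type_I 1 ?N R"
    unfolding type_I_def by (intro exI[of _ "\<lambda>_. R"]) auto
  moreover have "central_projection M R"
    using R(1) proj_R R_central by (simp add: central_projection_def)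
  ultimately have "R = 0"
    using no_I1 unfolding no_central_summands_of_type_I_def by blast
  then have "E = id_blinfun"
    by (simp add: R_def)
  then have "T = 0"
    using E(3) by simp
  then show "X = 0"
    using X by (simp add: T_def compose_adj_eq_0_iff)
qed

end

section \<open>Additivity of mixed Jordan triple derivations\<close>

locale mixed_triple_derivation = operator_star_algebra M
  for M :: "('h::complex_hilbert_space \<Rightarrow>\<^sub>L 'h) set" +
  fixes D :: "('h \<Rightarrow>\<^sub>L 'h) \<Rightarrow> ('h \<Rightarrow>\<^sub>L 'h)"
  assumes D_mem [simp, intro]: "A \<in> M \<Longrightarrow> D A \<in> M"
    and triple: "nonlinear_mixed_jordan_triple_star_derivation M D"
begin

text \<open>
  The bracket is the triple product with first argument \<open>1\<close>, twice \<open>BC - CB\<^sup>*\<close>; additivity is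
  derived from these special triple products alone.
\<close>

definition bracket where "bracket B C = star_commutator (B + B) C"

definition defect where "defect X Y = D (X + Y) - D X - D Y"

lemma bracket_mem [simp, intro]: "B \<in> M \<Longrightarrow> C \<in> M \<Longrightarrow> bracket B C \<in> M"
  by (simp add: bracket_def star_commutator_def)

lemma defect_mem [simp, intro]: "X \<in> M \<Longrightarrow> Y \<in> M \<Longrightarrow> defect X Y \<in> M"
  by (simp add: defect_def)

lemma defect_eq_0_iff: "defect X Y = 0 \<longleftrightarrow> D (X + Y) = D X + D Y"
  by (auto simp: defect_def algebra_simps)

lemma defect_commute: "defect X Y = defect Y X"
  by (simp add: defect_def algebra_simps)

lemma D_0 [simp]: "D 0 = 0"
  using triple zero_mem unfolding nonlinear_mixed_jordan_triple_star_derivation_def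
  by (fastforce simp: star_commutator_def star_jordan_def)

lemma bracket_alt: "B \<in> M \<Longrightarrow> bracket B C = (B \<cdot> C - C \<cdot> B\<^sup>\<star>) + (B \<cdot> C - C \<cdot> B\<^sup>\<star>)"
  by (simp add: bracket_def star_commutator_def compose_distribs algebra_simps)

lemma bracket_eq_0_iff: "B \<in> M \<Longrightarrow> bracket B C = 0 \<longleftrightarrow> B \<cdot> C = C \<cdot> B\<^sup>\<star>"
  by (simp add: bracket_alt double_eq_0_iff)

lemma bracket_add_left: "B \<in> M \<Longrightarrow> B' \<in> M \<Longrightarrow> bracket (B + B') C = bracket B C + bracket B' C"
  by (simp add: bracket_alt compose_distribs algebra_simps)

lemma bracket_add_right: "B \<in> M \<Longrightarrow> bracket B (C + C') = bracket B C + bracket B C'"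
  by (simp add: bracket_alt compose_distribs algebra_simps)

lemma bracket_diff_left: "B \<in> M \<Longrightarrow> B' \<in> M \<Longrightarrow> bracket (B - B') C = bracket B C - bracket B' C"
  by (simp add: bracket_alt compose_distribs algebra_simps)

lemma bracket_diff_right: "B \<in> M \<Longrightarrow> bracket B (C - C') = bracket B C - bracket B C'"
  by (simp add: bracket_alt compose_distribs algebra_simps)

lemma D_bracket:
  assumes "B \<in> M" "C \<in> M"
  shows "D (bracket B C) =
    star_commutator (star_jordan (D id_blinfun) B) C + bracket (D B) C + bracket B (D C)"
  using triple[unfolded nonlinear_mixed_jordan_triple_star_derivation_def, rule_format, OF id_mem assms]
  by (simp add: bracket_def star_jordan_def adj_id)

lemma D_bracket_add:
  assumes "B \<in> M" "B' \<in> M" "C \<in> M" "C' \<in> M" and "defect B B' = 0" "defect C C' = 0"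
  shows "D (bracket (B + B') (C + C')) =
    D (bracket B C) + D (bracket B C') + D (bracket B' C) + D (bracket B' C')"
proof -
  have jordan_add: "star_jordan U (B + B') = star_jordan U B + star_jordan U B'" for U
    by (simp add: star_jordan_def compose_distribs)
  have commutator_add: "star_commutator (S + S') (C + C') = star_commutator S C + star_commutator S C' +
      star_commutator S' C + star_commutator S' C'" if "S \<in> M" "S' \<in> M" for S S'
    using that by (simp add: star_commutator_def compose_distribs)
  have mem: "star_jordan (D id_blinfun) B \<in> M" "star_jordan (D id_blinfun) B' \<in> M"
    using assms by (simp_all add: star_jordan_def)
  note D_sums = assms(5,6)[unfolded defect_eq_0_iff]
  show ?thesis
    unfolding D_bracket[OF add_mem add_mem, OF assms(1-4)] D_bracket[OF assms(1,3)]
      D_bracket[OF assms(1,4)] D_bracket[OF assms(2,3)] D_bracket[OF assms(2,4)]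
    using assms(1-4)
    by (simp add: D_sums jordan_add commutator_add[OF mem] bracket_add_left bracket_add_right)
qed

text \<open>
  The triple identity is additive in each argument except for the values of \<open>D\<close>.  So if \<open>D\<close> is
  additive on the brackets of \<open>X\<close> and \<open>Y\<close> with a test element, then that test element also
  kills the defect of \<open>X\<close> and \<open>Y\<close>.
\<close>

lemma bracket_defect_right:
  assumes "B \<in> M" "X \<in> M" "Y \<in> M"
    and "defect (bracket B X) (bracket B Y) = 0"
  shows "bracket B (defect X Y) = 0"
proof -
  have "star_jordan (D id_blinfun) B \<in> M"
    using assms by (simp add: star_jordan_def)
  then have "star_commutator (star_jordan (D id_blinfun) B) (X + Y) =
      star_commutator (star_jordan (D id_blinfun) B) X + star_commutator (star_jordan (D id_blinfun) B) Y"
    by (simp add: star_commutator_def compose_distribs)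
  moreover have "D (bracket B (X + Y)) = D (bracket B X) + D (bracket B Y)"
    using assms by (simp add: defect_eq_0_iff bracket_add_right)
  ultimately have "bracket B (D (X + Y)) = bracket B (D X) + bracket B (D Y)"
    unfolding D_bracket[OF assms(1) add_mem[OF assms(2,3)]] D_bracket[OF assms(1,2)]
      D_bracket[OF assms(1,3)]
    using assms(1-3) by (simp add: bracket_add_right)
  then show ?thesis
    using assms(1-3) by (simp add: defect_def bracket_diff_right)
qed

lemma bracket_defect_left:
  assumes "C \<in> M" "X \<in> M" "Y \<in> M"
    and "defect (bracket X C) (bracket Y C) = 0"
  shows "bracket (defect X Y) C = 0"
proof -
  have "star_commutator (star_jordan (D id_blinfun) (X + Y)) C =
      star_commutator (star_jordan (D id_blinfun) X) C + star_commutator (star_jordan (D id_blinfun) Y) C"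
    using assms(1-3) by (simp add: star_commutator_def star_jordan_def compose_distribs algebra_simps)
  moreover have "D (bracket (X + Y) C) = D (bracket X C) + D (bracket Y C)"
    using assms by (simp add: defect_eq_0_iff bracket_add_left)
  ultimately have "bracket (D (X + Y)) C = bracket (D X) C + bracket (D Y) C"
    unfolding D_bracket[OF add_mem[OF assms(2,3)] assms(1)] D_bracket[OF assms(2,1)]
      D_bracket[OF assms(3,1)]
    using assms(1-3) by (simp add: bracket_add_left)
  then show ?thesis
    using assms(1-3) by (simp add: defect_def bracket_diff_left)
qed

text \<open>
  For self-adjoint \<open>E\<close>, the brackets with \<open>E\<close> and with \<open>\<i>E\<close> are the commutator and, up to the
  factor \<open>\<i>\<close>, the anticommutator with \<open>E\<close>.  If one of the two summands is killed, the defect is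
  killed as well.
\<close>

lemma defect_commute_with:
  assumes "E \<in> M" "E\<^sup>\<star> = E" "X \<in> M" "Y \<in> M" and "E \<cdot> X = X \<cdot> E"
  shows "E \<cdot> defect X Y = defect X Y \<cdot> E"
proof -
  have "bracket E X = 0"
    using assms by (simp add: bracket_eq_0_iff)
  then have "bracket E (defect X Y) = 0"
    using assms by (intro bracket_defect_right) (simp_all add: defect_eq_0_iff)
  then show ?thesis
    using assms by (simp add: bracket_eq_0_iff)
qed

lemma bracket_imaginary_eq_0_iff:
  assumes "E \<in> M" "E\<^sup>\<star> = E" "C \<in> M"
  shows "bracket (scale_op \<i> E) C = 0 \<longleftrightarrow> E \<cdot> C = - (C \<cdot> E)"
proof -
  have "bracket (scale_op \<i> E) C = 0 \<longleftrightarrow> scale_op \<i> (E \<cdot> C + C \<cdot> E) = 0"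
    using assms by (simp add: bracket_eq_0_iff scale_op_simps compose_scale_op compose_distribs
        eq_neg_iff_add_eq_0)
  then show ?thesis
    by (simp add: scale_op_eq_0_iff eq_neg_iff_add_eq_0)
qed

lemma defect_anticommute_with:
  assumes "E \<in> M" "E\<^sup>\<star> = E" "X \<in> M" "Y \<in> M" and "E \<cdot> X = - (X \<cdot> E)"
  shows "E \<cdot> defect X Y = - (defect X Y \<cdot> E)"
proof -
  have "bracket (scale_op \<i> E) X = 0"
    using assms by (simp add: bracket_imaginary_eq_0_iff)
  then have "bracket (scale_op \<i> E) (defect X Y) = 0"
    using assms by (intro bracket_defect_right) (simp_all add: defect_eq_0_iff)
  then show ?thesis
    using assms by (simp add: bracket_imaginary_eq_0_iff)
qed

end

locale peirce_decomposition = mixed_triple_derivation +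
  fixes P Q
  assumes P_mem [simp, intro]: "P \<in> M" and Q_mem [simp, intro]: "Q \<in> M"
    and P_adj [simp]: "P\<^sup>\<star> = P" and Q_adj [simp]: "Q\<^sup>\<star> = Q"
    and PP: "P \<cdot> P = P" and QQ: "Q \<cdot> Q = Q" and PQ: "P \<cdot> Q = 0" and QP: "Q \<cdot> P = 0"
    and P_plus_Q: "P + Q = id_blinfun"
begin

lemma swap: "peirce_decomposition M D Q P"
  by unfold_locales (simp_all add: PP QQ PQ QP P_plus_Q add.commute)

lemma left_multiples: "P \<cdot> (P \<cdot> X) = P \<cdot> X" "Q \<cdot> (Q \<cdot> X) = Q \<cdot> X" "P \<cdot> (Q \<cdot> X) = 0" "Q \<cdot> (P \<cdot> X) = 0"
  by (simp_all add: PP QQ PQ QP flip: compose_assoc)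

lemmas corner_simps = PP QQ PQ QP left_multiples compose_simps

lemma decompose: "X = P \<cdot> X \<cdot> P + P \<cdot> X \<cdot> Q + Q \<cdot> X \<cdot> P + Q \<cdot> X \<cdot> Q"
proof -
  have "X = (P + Q) \<cdot> X \<cdot> (P + Q)"
    by (simp add: P_plus_Q)
  then show ?thesis
    by (simp add: compose_distribs add_ac)
qed

text \<open>
  The symmetry \<open>P - Q\<close> commutes with diagonal and anticommutes with off-diagonal elements.  The
  defect inherits both properties, and this forces it to vanish.
\<close>

lemma additive_diagonal_off_diagonal:
  assumes X: "X \<in> M" "(P - Q) \<cdot> X = X \<cdot> (P - Q)" and Y: "Y \<in> M" "(P - Q) \<cdot> Y = - (Y \<cdot> (P - Q))"
  shows "defect X Y = 0"
proof -
  have S: "P - Q \<in> M" "(P - Q)\<^sup>\<star> = P - Q"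
    by simp_all
  have commute: "(P - Q) \<cdot> defect X Y = defect X Y \<cdot> (P - Q)"
    using X Y S by (intro defect_commute_with)
  have "(P - Q) \<cdot> defect Y X = - (defect Y X \<cdot> (P - Q))"
    using X Y S by (intro defect_anticommute_with)
  then have "(P - Q) \<cdot> defect X Y = - (defect X Y \<cdot> (P - Q))"
    by (simp only: defect_commute)
  then have "(P - Q) \<cdot> defect X Y = - ((P - Q) \<cdot> defect X Y)"
    unfolding commute[symmetric] .
  then have "(P - Q) \<cdot> defect X Y = 0"
    by (simp only: eq_uminus_iff)
  then have "(P - Q) \<cdot> ((P - Q) \<cdot> defect X Y) = 0"
    by simp
  then have "(P + Q) \<cdot> defect X Y = 0"
    by (simp add: corner_simps)
  then show ?thesis
    by (simp add: P_plus_Q)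
qed

text \<open>
  The anticommutator with \<open>Q\<close> kills the first summand and the one with \<open>P\<close> kills the second, so
  the defect anticommutes with \<open>P\<close>, with \<open>Q\<close>, and hence with \<open>P + Q = 1\<close>.
\<close>

lemma additive_diagonal:
  assumes "A \<in> M" "B \<in> M"
  shows "defect (P \<cdot> A \<cdot> P) (Q \<cdot> B \<cdot> Q) = 0"
proof -
  let ?T = "defect (P \<cdot> A \<cdot> P) (Q \<cdot> B \<cdot> Q)"
  have "Q \<cdot> ?T = - (?T \<cdot> Q)"
    using assms by (intro defect_anticommute_with) (simp_all add: corner_simps)
  moreover have "P \<cdot> defect (Q \<cdot> B \<cdot> Q) (P \<cdot> A \<cdot> P) = - (defect (Q \<cdot> B \<cdot> Q) (P \<cdot> A \<cdot> P) \<cdot> P)"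
    using assms by (intro defect_anticommute_with) (simp_all add: corner_simps)
  then have "P \<cdot> ?T = - (?T \<cdot> P)"
    by (simp only: defect_commute)
  ultimately have "(P + Q) \<cdot> ?T = - (?T \<cdot> (P + Q))"
    by (simp add: compose_distribs)
  then show ?thesis
    by (simp add: P_plus_Q eq_uminus_iff)
qed

text \<open>
  No bracket with a combination of \<open>P\<close> and \<open>Q\<close> on the left separates \<open>P M Q\<close> from \<open>Q M P\<close>, since
  the involution exchanges these corners.  Brackets with \<open>P\<close> or \<open>Q\<close> on the right do: they kill one
  of the summands and show that the off-diagonal corners of the defect vanish.  Its diagonal
  corners vanish because it anticommutes with \<open>P - Q\<close>.
\<close>

lemma additive_off_diagonal:
  assumes "A \<in> M" "B \<in> M"
  shows "defect (P \<cdot> A \<cdot> Q) (Q \<cdot> B \<cdot> P) = 0"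
proof -
  let ?X = "P \<cdot> A \<cdot> Q" and ?Y = "Q \<cdot> B \<cdot> P"
  define T where "T = defect ?X ?Y"
  have T: "T \<in> M"
    using assms by (simp add: T_def)
  have XY: "?X \<in> M" "?Y \<in> M"
    using assms by auto
  have "bracket ?X P = 0" "bracket ?Y Q = 0"
    using assms by (simp_all add: bracket_eq_0_iff corner_simps)
  then have "bracket T P = 0" "bracket T Q = 0"
    unfolding T_def using XY by (auto intro!: bracket_defect_left simp: defect_eq_0_iff)
  then have "T \<cdot> P = P \<cdot> T\<^sup>\<star>" "T \<cdot> Q = Q \<cdot> T\<^sup>\<star>"
    using T by (simp_all add: bracket_eq_0_iff)
  then have off: "Q \<cdot> (T \<cdot> P) = 0" "P \<cdot> (T \<cdot> Q) = 0"
    by (simp_all add: corner_simps)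
  have "(P - Q) \<cdot> T = - (T \<cdot> (P - Q))"
    unfolding T_def using assms by (intro defect_anticommute_with) (simp_all add: corner_simps)
  then have eq: "P \<cdot> T + T \<cdot> P = Q \<cdot> T + T \<cdot> Q"
    by (simp add: compose_distribs algebra_simps)
  have "P \<cdot> (P \<cdot> T + T \<cdot> P) \<cdot> P = P \<cdot> (Q \<cdot> T + T \<cdot> Q) \<cdot> P"
    "Q \<cdot> (P \<cdot> T + T \<cdot> P) \<cdot> Q = Q \<cdot> (Q \<cdot> T + T \<cdot> Q) \<cdot> Q"
    by (simp_all only: eq)
  then have "P \<cdot> (T \<cdot> P) = 0" "Q \<cdot> (T \<cdot> Q) = 0"
    by (simp_all add: corner_simps double_eq_0_iff)
  then have "T = 0"
    using off decompose[of T] by (simp add: compose_assoc)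
  then show ?thesis
    by (simp only: T_def)
qed

lemma D_decompose:
  assumes "X \<in> M"
  shows "D X = D (P \<cdot> X \<cdot> P) + D (P \<cdot> X \<cdot> Q) + D (Q \<cdot> X \<cdot> P) + D (Q \<cdot> X \<cdot> Q)"
proof -
  have "defect (P \<cdot> X \<cdot> P + Q \<cdot> X \<cdot> Q) (P \<cdot> X \<cdot> Q + Q \<cdot> X \<cdot> P) = 0"
    using assms by (intro additive_diagonal_off_diagonal) (simp_all add: corner_simps)
  moreover have "X = (P \<cdot> X \<cdot> P + Q \<cdot> X \<cdot> Q) + (P \<cdot> X \<cdot> Q + Q \<cdot> X \<cdot> P)"
    using decompose[of X] by (simp add: add_ac)
  ultimately have "D X = D (P \<cdot> X \<cdot> P + Q \<cdot> X \<cdot> Q) + D (P \<cdot> X \<cdot> Q + Q \<cdot> X \<cdot> P)"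
    by (metis defect_eq_0_iff)
  then show ?thesis
    using additive_diagonal[OF assms assms] additive_off_diagonal[OF assms assms]
    by (simp add: defect_eq_0_iff)
qed

text \<open>
  With \<open>X\<close> and \<open>Y\<close> half of the two summands, the bracket of \<open>P + X\<close> and \<open>Q + Y\<close> has the
  component \<open>2(X + Y)\<close> in the corner, and both arguments split additively because they mix
  diagonal and off-diagonal elements.
\<close>

lemma additive_off_diagonal_corner:
  assumes "A \<in> M" "B \<in> M"
  shows "defect (P \<cdot> A \<cdot> Q) (P \<cdot> B \<cdot> Q) = 0"
proof -
  define X where "X = P \<cdot> ((1/2) *\<^sub>R A) \<cdot> Q"
  define Y where "Y = P \<cdot> ((1/2) *\<^sub>R B) \<cdot> Q"
  have XX: "X + X = P \<cdot> A \<cdot> Q" and YY: "Y + Y = P \<cdot> B \<cdot> Q"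
    by (simp_all add: X_def Y_def compose_distribs flip: scaleR_add_left)
  have XY: "X \<in> M" "Y \<in> M"
    using assms by (simp_all add: X_def Y_def)
  have corners: "P \<cdot> X = X" "X \<cdot> Q = X" "Q \<cdot> X = 0" "X \<cdot> P = 0"
    "P \<cdot> Y = Y" "Y \<cdot> Q = Y" "Q \<cdot> Y = 0" "Y \<cdot> P = 0"
    by (simp_all add: X_def Y_def corner_simps)
  have adj_corners: "Q \<cdot> X\<^sup>\<star> = X\<^sup>\<star>" "X\<^sup>\<star> \<cdot> P = X\<^sup>\<star>" "P \<cdot> X\<^sup>\<star> = 0" "X\<^sup>\<star> \<cdot> Q = 0"
    using assms by (simp_all add: X_def corner_simps)
  have products: "P \<cdot> (Y \<cdot> Z) = Y \<cdot> Z" "Q \<cdot> (Y \<cdot> Z) = 0" "X \<cdot> (Y \<cdot> Z) = 0" "P \<cdot> (X \<cdot> Z) = X \<cdot> Z"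
    "Q \<cdot> (X \<cdot> Z) = 0" "Q \<cdot> (X\<^sup>\<star> \<cdot> Z) = X\<^sup>\<star> \<cdot> Z" "P \<cdot> (X\<^sup>\<star> \<cdot> Z) = 0" for Z
    using corners adj_corners by (metis compose_assoc compose_distribs(7))+
  define V where "V = Y \<cdot> X\<^sup>\<star>"
  define W where "W = bracket (P + X) (Q + Y)"
  have brackets: "bracket P Q = 0" "bracket P Y = Y + Y" "bracket X Q = X + X - X\<^sup>\<star> - X\<^sup>\<star>"
    "bracket X Y = - V - V"
    using XY products(3)[of Q] by (simp_all add: bracket_alt corners adj_corners corner_simps V_def)
  have W: "W = (X + X) + (Y + Y) + (- X\<^sup>\<star> - X\<^sup>\<star>) + (- V - V)"
    using XY by (simp add: W_def bracket_add_left bracket_add_right brackets)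
  have W_mem: "W \<in> M"
    using XY by (simp add: W_def)
  have W_corners: "P \<cdot> W \<cdot> P = - V - V" "P \<cdot> W \<cdot> Q = (X + X) + (Y + Y)"
    "Q \<cdot> W \<cdot> P = - X\<^sup>\<star> - X\<^sup>\<star>" "Q \<cdot> W \<cdot> Q = 0"
    by (simp_all add: W V_def corners adj_corners products compose_simps)
  have "D W = D (- V - V) + D ((X + X) + (Y + Y)) + D (- X\<^sup>\<star> - X\<^sup>\<star>)"
    using D_decompose[OF W_mem] by (simp add: W_corners)
  moreover have "D W = D (bracket P Q) + D (bracket P Y) + D (bracket X Q) + D (bracket X Y)"
    unfolding W_def
  proof (rule D_bracket_add)
    show "defect P X = 0"
      using XY by (intro additive_diagonal_off_diagonal) (simp_all add: corners corner_simps)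
    show "defect Q Y = 0"
      using XY by (intro additive_diagonal_off_diagonal) (simp_all add: corners corner_simps)
  qed (simp_all add: XY)
  moreover have "D (bracket X Q) = D (X + X) + D (- X\<^sup>\<star> - X\<^sup>\<star>)"
  proof -
    have "defect (P \<cdot> (X + X) \<cdot> Q) (Q \<cdot> (- X\<^sup>\<star> - X\<^sup>\<star>) \<cdot> P) = 0"
      using XY by (intro additive_off_diagonal) simp_all
    then show ?thesis
      by (simp add: defect_eq_0_iff brackets corners adj_corners compose_distribs)
         (simp add: algebra_simps)
  qed
  ultimately have "D ((X + X) + (Y + Y)) = D (X + X) + D (Y + Y)"
    by (simp add: brackets algebra_simps)
  then show ?thesis
    by (simp add: defect_eq_0_iff XX YY)
qed

text \<open>
  The bracket with an element \<open>Q Z P\<close> moves the corner \<open>P M P\<close> into the off-diagonal corners,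
  where additivity is already known; only \<open>Q Z P T = 0\<close> can be concluded for the defect \<open>T\<close>.
\<close>

lemma diagonal_corner_defect:
  assumes "A \<in> M" "B \<in> M" "Z \<in> M"
  defines "T \<equiv> defect (P \<cdot> A \<cdot> P) (P \<cdot> B \<cdot> P)"
  shows "Q \<cdot> T = 0" "Q \<cdot> Z \<cdot> T = 0"
proof -
  have T: "T \<in> M"
    using assms by (simp add: T_def)
  have anti: "Q \<cdot> T = - (T \<cdot> Q)"
    unfolding T_def using assms(1-3) by (intro defect_anticommute_with) (simp_all add: corner_simps)
  have "Q \<cdot> (Q \<cdot> T) \<cdot> Q = Q \<cdot> (- (T \<cdot> Q)) \<cdot> Q"
    by (simp only: anti)
  then have "Q \<cdot> (T \<cdot> Q) = 0"
    by (simp add: corner_simps eq_neg_iff_add_eq_0 double_eq_0_iff)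
  moreover have "Q \<cdot> (Q \<cdot> T) = Q \<cdot> (- (T \<cdot> Q))"
    by (simp only: anti)
  ultimately show QT: "Q \<cdot> T = 0"
    by (simp add: corner_simps)
  interpret swap: peirce_decomposition M D Q P
    by (rule swap)
  define X where "X = Q \<cdot> Z \<cdot> P"
  have X: "X \<in> M" "Q \<cdot> X = X" "X \<cdot> P = X"
    using assms(3) by (simp_all add: X_def corner_simps)
  define L where "L C = Q \<cdot> ((Z \<cdot> P \<cdot> C) + (Z \<cdot> P \<cdot> C)) \<cdot> P" for C
  define U where "U C = P \<cdot> (- (C \<cdot> P \<cdot> Z\<^sup>\<star>) - (C \<cdot> P \<cdot> Z\<^sup>\<star>)) \<cdot> Q" for C
  have mem: "L C \<in> M" "U C \<in> M" if "C \<in> M" for C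
    using that assms(3) by (simp_all add: L_def U_def)
  have bracket_X: "bracket X (P \<cdot> C \<cdot> P) = U C + L C" for C
    using X(1) assms(3) by (simp add: bracket_alt X_def L_def U_def corner_simps)
  have split: "D (U C + L C') = D (U C) + D (L C')" if "C \<in> M" "C' \<in> M" for C C'
    using additive_off_diagonal that assms(3) unfolding L_def U_def defect_eq_0_iff by simp
  have L_add: "D (L A + L B) = D (L A) + D (L B)"
    using swap.additive_off_diagonal_corner assms(1-3) unfolding L_def defect_eq_0_iff by simp
  have U_add: "D (U A + U B) = D (U A) + D (U B)"
    using additive_off_diagonal_corner assms(1-3) unfolding U_def defect_eq_0_iff by simp
  have sums: "L (A + B) = L A + L B" "U (A + B) = U A + U B"
    by (simp_all add: L_def U_def compose_distribs)
  have "(U A + L A) + (U B + L B) = U (A + B) + L (A + B)"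
    by (simp add: sums)
  then have "D ((U A + L A) + (U B + L B)) = D (U (A + B)) + D (L (A + B))"
    using split[of "A + B" "A + B"] assms(1,2) by simp
  also have "\<dots> = D (U A + L A) + D (U B + L B)"
    using split assms(1,2) by (simp add: sums L_add U_add)
  finally have "defect (bracket X (P \<cdot> A \<cdot> P)) (bracket X (P \<cdot> B \<cdot> P)) = 0"
    by (simp add: bracket_X defect_eq_0_iff)
  then have "bracket X T = 0"
    unfolding T_def using assms(1,2) X(1) by (intro bracket_defect_right) simp_all
  then have "X \<cdot> T = T \<cdot> X\<^sup>\<star>"
    using X(1) by (simp add: bracket_eq_0_iff)
  then have "Q \<cdot> (X \<cdot> T) = Q \<cdot> T \<cdot> X\<^sup>\<star>"
    by (simp add: compose_assoc)
  then have "X \<cdot> T = 0"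
    by (simp add: QT X(2) flip: compose_assoc)
  moreover have "P \<cdot> T = T"
    using QT arg_cong[OF P_plus_Q, of "\<lambda>A. A \<cdot> T"] by (simp add: compose_distribs)
  ultimately show "Q \<cdot> Z \<cdot> T = 0"
    by (simp add: X_def compose_assoc)
qed

text \<open>
  Only the diagonal corners contribute to a defect.  On the contribution \<open>T\<close> of \<open>P M P\<close> both \<open>P Z\<close>
  and \<open>Z P\<close> act as \<open>Z\<close>; on that of \<open>Q M Q\<close> both act as \<open>0\<close>.
\<close>

lemma commutator_annihilates_defect:
  assumes "A \<in> M" "B \<in> M" "Z \<in> M"
  shows "(P \<cdot> Z - Z \<cdot> P) \<cdot> defect A B = 0"
proof -
  interpret swap: peirce_decomposition M D Q P
    by (rule swap)
  define T where "T = defect (P \<cdot> A \<cdot> P) (P \<cdot> B \<cdot> P)"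
  define T' where "T' = defect (Q \<cdot> A \<cdot> Q) (Q \<cdot> B \<cdot> Q)"
  have T: "Q \<cdot> T = 0" "Q \<cdot> Z \<cdot> T = 0"
    using diagonal_corner_defect[OF assms] by (simp_all add: T_def)
  have T': "P \<cdot> T' = 0" "P \<cdot> Z \<cdot> T' = 0"
    using swap.diagonal_corner_defect[OF assms] by (simp_all add: T'_def)
  have id_split: "P \<cdot> X = X - Q \<cdot> X" for X
    using arg_cong[OF P_plus_Q, of "\<lambda>A. A \<cdot> X"] by (simp add: compose_distribs algebra_simps)
  have "D (P \<cdot> A \<cdot> Q + P \<cdot> B \<cdot> Q) = D (P \<cdot> A \<cdot> Q) + D (P \<cdot> B \<cdot> Q)"
    "D (Q \<cdot> A \<cdot> P + Q \<cdot> B \<cdot> P) = D (Q \<cdot> A \<cdot> P) + D (Q \<cdot> B \<cdot> P)"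
    using additive_off_diagonal_corner[OF assms(1,2)] swap.additive_off_diagonal_corner[OF assms(1,2)]
    by (simp_all add: defect_eq_0_iff)
  then have "defect A B = T + T'"
    unfolding T_def T'_def defect_def
    using D_decompose[of "A + B"] D_decompose[OF assms(1)] D_decompose[OF assms(2)] assms(1,2)
    by (simp add: compose_distribs)
  moreover have "(P \<cdot> Z - Z \<cdot> P) \<cdot> T = 0"
    using T id_split[of "Z \<cdot> T"] id_split[of T] by (simp add: compose_simps)
  moreover have "(P \<cdot> Z - Z \<cdot> P) \<cdot> T' = 0"
    using T' by (simp add: compose_simps)
  ultimately show ?thesis
    by (simp add: compose_distribs)
qed

end

section \<open>From additivity to derivations\<close>

lemma additive_star_derivation_imp_mixed_triple_derivation:
  assumes "operator_star_algebra M" and D: "D \<in> M \<rightarrow> M" and "additive_star_derivation M D"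
  shows "nonlinear_mixed_jordan_triple_star_derivation M D"
proof -
  interpret operator_star_algebra M by fact
  have D_mem [simp]: "D A \<in> M" if "A \<in> M" for A
    using D that by auto
  have D_add [simp]: "D (A + B) = D A + D B"
    and D_mult [simp]: "D (A \<cdot> B) = D A \<cdot> B + A \<cdot> D B"
    and D_adj [simp]: "D (A\<^sup>\<star>) = (D A)\<^sup>\<star>" if "A \<in> M" "B \<in> M" for A B
    using assms(3) that by (auto simp: additive_star_derivation_def)
  have D_0: "D 0 = 0"
    using D_add[of 0 0] by simp
  have D_minus: "D (- A) = - D A" if "A \<in> M" for A
    using D_add[of A "- A"] that by (simp add: D_0 eq_neg_iff_add_eq_0 add.commute)
  have D_diff [simp]: "D (A - B) = D A - D B" if "A \<in> M" "B \<in> M" for A B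
    using D_add[of A "- B"] that by (simp add: D_minus)
  show ?thesis
    unfolding nonlinear_mixed_jordan_triple_star_derivation_def star_commutator_def star_jordan_def
    by (simp add: compose_simps algebra_simps)
qed

context mixed_triple_derivation
begin

text \<open>
  Evaluating the triple product at \<open>(1, \<i>, C)\<close> gives \<open>D(\<i>C) = \<i> D(C)\<close>.  The bracket with \<open>\<i>B\<close> in
  place of \<open>B\<close> then turns the rule for \<open>BC - CB\<^sup>*\<close> into one for \<open>BC + CB\<^sup>*\<close>, and half the sum of
  the two is the product rule.
\<close>

lemma additive_imp_additive_star_derivation:
  assumes additive: "\<And>X Y. X \<in> M \<Longrightarrow> Y \<in> M \<Longrightarrow> D (X + Y) = D X + D Y"
  shows "additive_star_derivation M D"
proof -
  let ?I = "id_blinfun :: 'h \<Rightarrow>\<^sub>L 'h"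
  have D_minus: "D (- A) = - D A" if "A \<in> M" for A
    using additive[of A "- A"] that by (simp add: eq_neg_iff_add_eq_0 add.commute)
  have D_diff: "D (A - B) = D A - D B" if "A \<in> M" "B \<in> M" for A B
    using additive[of A "- B"] that by (simp add: D_minus)
  define U where "U = D ?I"
  define V where "V = D (scale_op \<i> ?I)"
  have UV: "U \<in> M" "V \<in> M"
    by (simp_all add: U_def V_def)
  have "bracket ?I ?I = 0"
    by (simp add: bracket_eq_0_iff adj_id)
  then have "D 0 = star_commutator (star_jordan U ?I) ?I + bracket U ?I + bracket ?I U"
    using D_bracket[of ?I ?I] by (simp add: U_def)
  then have "bracket U ?I = 0"
    using UV by (simp add: bracket_alt star_commutator_def star_jordan_def adj_id)
  then have U_adj: "U\<^sup>\<star> = U"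
    using UV by (simp add: bracket_eq_0_iff)
  have bracket_i: "bracket (scale_op \<i> ?I) C = scale_op \<i> C + scale_op \<i> C + (scale_op \<i> C + scale_op \<i> C)"
    if "C \<in> M" for C
    using that by (simp add: bracket_alt scale_op_simps compose_scale_op compose_distribs adj_id)
  have D_4i: "(D (scale_op \<i> C) + D (scale_op \<i> C)) + (D (scale_op \<i> C) + D (scale_op \<i> C)) =
      star_commutator (star_jordan U (scale_op \<i> ?I)) C + bracket V C +
      (scale_op \<i> (D C) + scale_op \<i> (D C) + (scale_op \<i> (D C) + scale_op \<i> (D C)))"
    if C: "C \<in> M" for C
    using D_bracket[of "scale_op \<i> ?I" C] C by (simp add: bracket_i additive U_def V_def)
  define W where "W = scale_op \<i> U"
  have W: "W \<in> M" "W\<^sup>\<star> = - W"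
    using UV by (simp_all add: W_def U_adj scale_op_simps)
  have "star_commutator (star_jordan U (scale_op \<i> ?I)) ?I = W + W + (W + W)"
    using UV W by (simp add: star_commutator_def star_jordan_def U_adj scale_op_simps compose_scale_op
        compose_distribs flip: W_def)
  then have "(V + V) + (V + V) = (W + W + (W + W)) + ((V - V\<^sup>\<star>) + (V - V\<^sup>\<star>)) + (W + W + (W + W))"
    using D_4i[of ?I] UV by (simp add: bracket_alt flip: V_def U_def W_def)
  then have "(V + V\<^sup>\<star>) + (V + V\<^sup>\<star>) = (W + W + (W + W)) + (W + W + (W + W))"
    by (simp add: algebra_simps)
  then have V_sum: "V + V\<^sup>\<star> = W + W + (W + W)"
    by (simp only: double_eq_iff)
  then have "(V + V\<^sup>\<star>)\<^sup>\<star> = (W + W + (W + W))\<^sup>\<star>"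
    by simp
  then have "V + V\<^sup>\<star> = - (W + W + (W + W))"
    using UV W by (simp add: add.commute)
  then have "W + W + (W + W) = - (W + W + (W + W))"
    unfolding V_sum .
  then have "W + W + (W + W) = 0"
    by (simp only: eq_uminus_iff)
  then have "W = 0"
    by (simp only: double_eq_0_iff)
  then have U0: "U = 0"
    by (simp add: W_def scale_op_eq_0_iff)
  have V_adj: "V\<^sup>\<star> = - V"
    using V_sum \<open>W = 0\<close> by (simp add: eq_neg_iff_add_eq_0 add.commute)
  have D_2i: "D (scale_op \<i> C) + D (scale_op \<i> C) =
      (V \<cdot> C + C \<cdot> V) + (scale_op \<i> (D C) + scale_op \<i> (D C))" if C: "C \<in> M" for C
  proof -
    have "star_commutator (star_jordan U (scale_op \<i> ?I)) C = 0"
      by (simp add: star_commutator_def star_jordan_def U0 compose_distribs)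
    moreover have "bracket V C = (V \<cdot> C + C \<cdot> V) + (V \<cdot> C + C \<cdot> V)"
      using UV by (simp add: bracket_alt V_adj compose_distribs)
    ultimately have "(D (scale_op \<i> C) + D (scale_op \<i> C)) + (D (scale_op \<i> C) + D (scale_op \<i> C)) =
        ((V \<cdot> C + C \<cdot> V) + (scale_op \<i> (D C) + scale_op \<i> (D C))) +
        ((V \<cdot> C + C \<cdot> V) + (scale_op \<i> (D C) + scale_op \<i> (D C)))"
      using D_4i[OF C] by (simp add: add_ac)
    then show ?thesis
      by (simp only: double_eq_iff)
  qed
  \<comment> \<open>Multiplying by \<open>\<i>\<close> twice must give \<open>D (- C) = - D C\<close>.\<close>
  have "V + V = 0"
  proof -
    have "- D ?I - D ?I = scale_op \<i> V + scale_op \<i> V + (scale_op \<i> V + scale_op \<i> V)"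
      using D_2i[of "scale_op \<i> ?I"] UV
      by (simp add: scale_op_simps compose_scale_op D_minus flip: V_def)
    then have "scale_op \<i> V + scale_op \<i> V + (scale_op \<i> V + scale_op \<i> V) = 0"
      by (simp add: U0 flip: U_def)
    then have "scale_op \<i> V = 0"
      by (simp only: double_eq_0_iff)
    then show ?thesis
      by (simp add: scale_op_eq_0_iff)
  qed
  then have "V = 0"
    by (simp only: double_eq_0_iff)
  then have D_i: "D (scale_op \<i> C) = scale_op \<i> (D C)" if "C \<in> M" for C
    using D_2i[OF that] by (simp add: compose_distribs double_eq_iff)
  have minus_rule: "D (B \<cdot> C) - D (C \<cdot> B\<^sup>\<star>) =
      (D B \<cdot> C - C \<cdot> (D B)\<^sup>\<star>) + (B \<cdot> D C - D C \<cdot> B\<^sup>\<star>)" if BC: "B \<in> M" "C \<in> M" for B C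
  proof -
    have "D (bracket B C) = bracket (D B) C + bracket B (D C)"
      using D_bracket[OF BC] by (simp add: U0 star_commutator_def star_jordan_def compose_distribs flip: U_def)
    then have "(D (B \<cdot> C) - D (C \<cdot> B\<^sup>\<star>)) + (D (B \<cdot> C) - D (C \<cdot> B\<^sup>\<star>)) =
        ((D B \<cdot> C - C \<cdot> (D B)\<^sup>\<star>) + (B \<cdot> D C - D C \<cdot> B\<^sup>\<star>)) +
        ((D B \<cdot> C - C \<cdot> (D B)\<^sup>\<star>) + (B \<cdot> D C - D C \<cdot> B\<^sup>\<star>))"
      using BC by (simp add: bracket_alt additive D_diff algebra_simps)
    then show ?thesis
      by (simp only: double_eq_iff)
  qed
  have plus_rule: "D (B \<cdot> C) + D (C \<cdot> B\<^sup>\<star>) =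
      (D B \<cdot> C + C \<cdot> (D B)\<^sup>\<star>) + (B \<cdot> D C + D C \<cdot> B\<^sup>\<star>)" if BC: "B \<in> M" "C \<in> M" for B C
  proof -
    have "scale_op \<i> (D (B \<cdot> C) + D (C \<cdot> B\<^sup>\<star>) -
        ((D B \<cdot> C + C \<cdot> (D B)\<^sup>\<star>) + (B \<cdot> D C + D C \<cdot> B\<^sup>\<star>))) = 0"
      using minus_rule[of "scale_op \<i> B" C] BC
      by (simp add: scale_op_simps compose_scale_op compose_distribs D_i D_minus)
    then show ?thesis
      by (simp add: scale_op_eq_0_iff)
  qed
  have product: "D (B \<cdot> C) = D B \<cdot> C + B \<cdot> D C" if BC: "B \<in> M" "C \<in> M" for B C
  proof -
    have "D (B \<cdot> C) + D (B \<cdot> C) = (D B \<cdot> C + B \<cdot> D C) + (D B \<cdot> C + B \<cdot> D C)"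
      using arg_cong2[OF minus_rule[OF BC] plus_rule[OF BC], of "(+)"] by (simp add: algebra_simps)
    then show ?thesis
      by (simp only: double_eq_iff)
  qed
  have "D (B\<^sup>\<star>) = (D B)\<^sup>\<star>" if "B \<in> M" for B
    using minus_rule[of B ?I] that by (simp add: U0 compose_distribs flip: U_def)
  then show ?thesis
    using additive product by (simp add: additive_star_derivation_def)
qed

end

text \<open>
  Every projection \<open>P\<close> of \<open>M\<close> gives a Peirce decomposition, so all commutators with projections
  annihilate all defects.
\<close>

lemma (in von_neumann) mixed_triple_derivation_additive:
  assumes "no_central_summands_of_type_I 1 M" and D: "D \<in> M \<rightarrow> M"
    and "nonlinear_mixed_jordan_triple_star_derivation M D" and XY: "X \<in> M" "Y \<in> M"
  shows "D (X + Y) = D X + D Y"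
proof -
  interpret mixed_triple_derivation M D
    using assms by unfold_locales auto
  have "defect X Y = 0"
  proof (rule annihilator_of_projection_commutators)
    fix P A assume P: "P \<in> M" "projection P" and A: "A \<in> M"
    interpret peirce_decomposition M D P "id_blinfun - P"
      using P by unfold_locales (simp_all add: projection_def adj_id compose_distribs)
    show "(P \<cdot> A - A \<cdot> P) \<cdot> defect X Y = 0"
      by (rule commutator_annihilates_defect[OF XY A])
  qed (use assms in auto)
  then show ?thesis
    by (simp add: defect_eq_0_iff)
qed

theorem corollary3p2:
  fixes M :: "('h::complex_hilbert_space \<Rightarrow>\<^sub>L 'h) set"
    and \<Phi> :: "('h \<Rightarrow>\<^sub>L 'h) \<Rightarrow> ('h \<Rightarrow>\<^sub>L 'h)"
  assumes "von_neumann_algebra M"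
    and "no_central_summands_of_type_I 1 M"
    and "\<Phi> \<in> M \<rightarrow> M"
  shows "nonlinear_mixed_jordan_triple_star_derivation M \<Phi> \<longleftrightarrow> additive_star_derivation M \<Phi>"
proof
  interpret von_neumann M
    using assms(1) unfolding von_neumann_algebra_def by unfold_locales auto
  show "additive_star_derivation M \<Phi>" if triple: "nonlinear_mixed_jordan_triple_star_derivation M \<Phi>"
  proof -
    interpret mixed_triple_derivation M \<Phi>
      using assms(3) triple by unfold_locales auto
    show ?thesis
      by (rule additive_imp_additive_star_derivation)
        (rule mixed_triple_derivation_additive[OF assms(2,3) triple])
  qed
  show "nonlinear_mixed_jordan_triple_star_derivation M \<Phi>" if "additive_star_derivation M \<Phi>"
    by (rule additive_star_derivation_imp_mixed_triple_derivation[OF _ assms(3) that]) unfold_locales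
qed

end
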